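(* Let $\Omega\subseteq\mathcal{W}$ be any fixed class of kernels, let $q\ge1$ be an integer, let $\mathfrak{a}\subseteq R_q$ be an ideal and let $g\in\mathcal{A}$. Suppose $\theta_q(g)$ vanishes on $$Z(\mathfrak{a})=\{X\in\mathbb{C}^{q(q+1)/2}: h(X)=0\text{ for every }h\in\mathfrak{a}\}.$$ Let $V:=\mathrm{V}_q(\mathfrak{a})=\mathrm{V}_\Omega(\theta_q^{-1}(\mathfrak{a}))$. Then $$g\in\mathrm{I}_{\mathcal{A}}(V).$$ Equivalently, $\theta_q(g)\in\mathrm{I}_q(V)$.
   Context: A kernel is a bounded symmetric measurable function $W:[0,1]^2\to\mathbb{R}$; $\mathcal{W}$ denotes the set of all kernels. For a kernel $W$ and a finite loopless multigraph $F=(V,E)$, the homomorphism density is $t(F,W)=\int_{[0,1]^V}\prod_{ij\in E}W(x_i,x_j)\prod_{i\in V}dx_i$ (product over edges with multiplicity). $\mathcal{A}$ is the complex vector space of quantum graphs, i.e. finite formal $\mathbb{C}$-linear combinations of unlabeled finite loopless multigraphs (basis: isomorphism classes). It is a commutative $\mathbb{C}$-algebra with product $FG:=F\sqcup G$ (disjoint union) extended bilinearly, and unit the empty graph $K_0$. The density extends linearly: $t(\sum_i\alpha_iF_i,W)=\sum_i\alpha_i t(F_i,W)$. For an integer $q\ge1$, $S_q=\mathbb{C}[x_{ij}:1\le i\le j\le q]$ is the polynomial ring in the entries of a symmetric $q\times q$ matrix (with $x_{ij}=x_{ji}$), the symmetric group $\mathfrak{S}_q$ acts on $S_q$ by simultaneously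 permuting the indices, and $R_q=S_q^{\mathfrak{S}_q}$ is the invariant ring. The linear map $\theta_q:\mathcal{A}\to R_q$ is defined on multigraphs by $$\theta_q(F)=q^{-|V(F)|}\sum_{\varphi:V(F)\to[q]}\ \prod_{uv\in E(F)}x_{\varphi(u)\varphi(v)}.$$ For $Q\subseteq\mathcal{A}$, $\mathrm{V}_\Omega(Q)=\{W\in\Omega: t(g,W)=0\text{ for every }g\in Q\}$. For $Y\subseteq\Omega$, $\mathrm{I}_{\mathcal{A}}(Y)=\{g\in\mathcal{A}: t(g,W)=0\text{ for every }W\in Y\}$ and $\mathrm{I}_q(Y)=\theta_q(\mathrm{I}_{\mathcal{A}}(Y))\subseteq R_q$. *)

theory Defs
  imports
    "HOL-Probability.Probability"
    "HOL-Algebra.Ideal"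
    "HOL-Combinatorics.Permutations"
    "HOL-Library.Poly_Mapping"
    "HOL-Library.Uprod"
    "HOL-Library.Multiset"
begin

section \<open>Kernels\<close>

text \<open>Kernels are represented by total functions; only their values on the unit square matter.
  Measurable means Lebesgue measurable.\<close>

definition kernels :: "(real \<times> real \<Rightarrow> real) set" where
  "kernels = {W. W \<in> borel_measurable (lebesgue_on ({0..1} \<times> {0..1})) \<and>
                 bounded (W ` ({0..1} \<times> {0..1})) \<and>
                 (\<forall>x\<in>{0..1}. \<forall>y\<in>{0..1}. W (x, y) = W (y, x))}"


section \<open>Finite loopless multigraphs up to isomorphism\<close>

text \<open>A labelled multigraph has a finite vertex set of natural numbers and a multiset of edges,
  which are unordered pairs of distinct vertices.\<close>

type_synonym raw_multigraph = "nat set \<times> nat uprod multiset"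

definition is_multigraph :: "raw_multigraph \<Rightarrow> bool" where
  "is_multigraph G \<longleftrightarrow> finite (fst G) \<and> (\<forall>e\<in>#snd G. set_uprod e \<subseteq> fst G \<and> proper_uprod e)"

definition multigraph_iso :: "raw_multigraph \<Rightarrow> raw_multigraph \<Rightarrow> bool" where
  "multigraph_iso G H \<longleftrightarrow> is_multigraph G \<and> is_multigraph H \<and>
     (\<exists>f. bij_betw f (fst G) (fst H) \<and> image_mset (map_uprod f) (snd G) = snd H)"

lemma map_uprod_comp: "map_uprod f (map_uprod g e) = map_uprod (f \<circ> g) e"
  by (cases e) auto

lemma map_uprod_comp': "map_uprod f \<circ> map_uprod g = map_uprod (f \<circ> g)"
  by (simp add: fun_eq_iff map_uprod_comp)

lemma map_uprod_ident: "map_uprod (\<lambda>x. x) = (\<lambda>e. e)"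
proof
  show "map_uprod (\<lambda>x. x) e = e" for e :: "'a uprod" by (cases e) auto
qed

lemma map_uprod_cong_on: "(\<And>x. x \<in> set_uprod e \<Longrightarrow> f x = g x) \<Longrightarrow> map_uprod f e = map_uprod g e"
  by (cases e) auto

lemma set_map_uprod: "set_uprod (map_uprod f e) = f ` set_uprod e"
  by (cases e) auto

lemma multigraph_iso_refl: "is_multigraph G \<Longrightarrow> multigraph_iso G G"
  unfolding multigraph_iso_def
  by (auto intro!: exI[of _ "\<lambda>x. x"] simp: map_uprod_ident bij_betw_def)

lemma multigraph_iso_sym:
  assumes "multigraph_iso G H" shows "multigraph_iso H G"
proof -
  obtain f where f: "bij_betw f (fst G) (fst H)" "image_mset (map_uprod f) (snd G) = snd H"
    and G: "is_multigraph G" and H: "is_multigraph H"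
    using assms unfolding multigraph_iso_def by blast
  let ?g = "inv_into (fst G) f"
  have "image_mset (map_uprod ?g) (snd H) = image_mset (\<lambda>e. map_uprod ?g (map_uprod f e)) (snd G)"
    by (simp flip: f(2) add: multiset.map_comp comp_def)
  also have "\<dots> = image_mset (\<lambda>e. e) (snd G)"
  proof (rule image_mset_cong)
    fix e assume "e \<in># snd G"
    hence "set_uprod e \<subseteq> fst G" using G unfolding is_multigraph_def by blast
    hence "map_uprod (?g \<circ> f) e = map_uprod (\<lambda>x. x) e"
      using f(1) by (intro map_uprod_cong_on) (auto simp: bij_betw_def)
    thus "map_uprod ?g (map_uprod f e) = e" by (simp add: map_uprod_comp map_uprod_ident)
  qed
  finally show ?thesis
    using bij_betw_inv_into[OF f(1)] G H unfolding multigraph_iso_def by auto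
qed

lemma multigraph_iso_trans:
  assumes "multigraph_iso G H" "multigraph_iso H K" shows "multigraph_iso G K"
proof -
  obtain f where f: "bij_betw f (fst G) (fst H)" "image_mset (map_uprod f) (snd G) = snd H"
    using assms unfolding multigraph_iso_def by blast
  obtain g where g: "bij_betw g (fst H) (fst K)" "image_mset (map_uprod g) (snd H) = snd K"
    using assms unfolding multigraph_iso_def by blast
  have "image_mset (map_uprod (g \<circ> f)) (snd G) = snd K"
    by (simp flip: g(2) f(2) add: multiset.map_comp map_uprod_comp comp_def)
  thus ?thesis
    using bij_betw_trans[OF f(1) g(1)] assms unfolding multigraph_iso_def by blast
qed

lemma is_multigraph_empty: "is_multigraph ({}, {#})"
  by (simp add: is_multigraph_def)

quotient_type multigraph = raw_multigraph / partial: multigraph_iso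
proof (rule part_equivpI)
  show "\<exists>G. multigraph_iso G G"
    using multigraph_iso_refl[OF is_multigraph_empty] by blast
  show "symp multigraph_iso" by (rule sympI) (rule multigraph_iso_sym)
  show "transp multigraph_iso" by (rule transpI) (rule multigraph_iso_trans)
qed

text \<open>Disjoint union makes the isomorphism classes a commutative monoid. It is written
  additively, with the empty graph as zero, so that the convolution product of \<open>\<Rightarrow>\<^sub>0\<close>
  below is the bilinear extension of disjoint union.\<close>

definition raw_disjoint_union :: "raw_multigraph \<Rightarrow> raw_multigraph \<Rightarrow> raw_multigraph" where
  "raw_disjoint_union G H =
     ((sum_encode \<circ> Inl) ` fst G \<union> (sum_encode \<circ> Inr) ` fst H,
      image_mset (map_uprod (sum_encode \<circ> Inl)) (snd G) +
      image_mset (map_uprod (sum_encode \<circ> Inr)) (snd H))"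

lemma inj_encode: "inj_on (sum_encode \<circ> Inl) A" "inj_on (sum_encode \<circ> Inr) B"
  by (auto intro!: inj_onI simp: sum_encode_eq)

lemma proper_map_uprod: "inj_on f (set_uprod e) \<Longrightarrow> proper_uprod (map_uprod f e) = proper_uprod e"
  by (cases e) (auto dest: inj_onD)

lemma is_multigraph_disjoint_union:
  assumes "is_multigraph G" "is_multigraph H"
  shows "is_multigraph (raw_disjoint_union G H)"
proof -
  have *: "set_uprod (map_uprod f e) \<subseteq> f ` fst K \<and> proper_uprod (map_uprod f e)"
    if "is_multigraph K" "inj f" "e \<in># snd K" for f :: "nat \<Rightarrow> nat" and K e
  proof -
    have "set_uprod e \<subseteq> fst K" "proper_uprod e" using that unfolding is_multigraph_def by blast+
    thus ?thesis using that(2) by (simp add: set_map_uprod proper_map_uprod image_mono inj_on_subset)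
  qed
  have "finite (fst (raw_disjoint_union G H))"
    using assms by (simp add: raw_disjoint_union_def is_multigraph_def)
  moreover have "set_uprod e \<subseteq> fst (raw_disjoint_union G H) \<and> proper_uprod e"
    if "e \<in># snd (raw_disjoint_union G H)" for e
  proof -
    from that consider e' where "e' \<in># snd G" "e = map_uprod (sum_encode \<circ> Inl) e'"
      | e' where "e' \<in># snd H" "e = map_uprod (sum_encode \<circ> Inr) e'"
      by (auto simp: raw_disjoint_union_def)
    thus ?thesis
    proof cases
      case 1
      thus ?thesis using *[OF assms(1) inj_encode(1) 1(1)] by (auto simp: raw_disjoint_union_def)
    next
      case 2
      thus ?thesis using *[OF assms(2) inj_encode(2) 2(1)] by (auto simp: raw_disjoint_union_def)
    qed
  qed
  ultimately show ?thesis unfolding is_multigraph_def by blast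
qed

text \<open>A map on the vertices of a disjoint union is given by its values on the two parts.\<close>

lemma iso_from_disjoint_union:
  assumes "is_multigraph G" "is_multigraph H" "is_multigraph K"
    and bij: "inj_on f (fst G)" "inj_on g (fst H)" "f ` fst G \<inter> g ` fst H = {}"
      "f ` fst G \<union> g ` fst H = fst K"
    and E: "image_mset (map_uprod f) (snd G) + image_mset (map_uprod g) (snd H) = snd K"
  shows "multigraph_iso (raw_disjoint_union G H) K"
proof -
  define h where "h = case_sum f g \<circ> sum_decode"
  have hL: "h \<circ> (sum_encode \<circ> Inl) = f" and hR: "h \<circ> (sum_encode \<circ> Inr) = g"
    by (auto simp: h_def fun_eq_iff)
  have "inj_on h (fst (raw_disjoint_union G H))"
  proof -
    let ?A = "(sum_encode \<circ> Inl) ` fst G" and ?B = "(sum_encode \<circ> Inr) ` fst H"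
    have "inj_on h ?A" "inj_on h ?B"
      using bij(1,2) hL hR by (auto intro!: inj_on_imageI simp del: comp_apply)
    moreover have "h ` ?A \<inter> h ` ?B = {}"
      using bij(3) by (simp only: image_comp hL hR)
    hence "h ` (?A - ?B) \<inter> h ` (?B - ?A) = {}" by blast
    ultimately show ?thesis
      unfolding raw_disjoint_union_def fst_conv inj_on_Un by (intro conjI)
  qed
  moreover have "h ` fst (raw_disjoint_union G H) = fst K"
    using bij(4) by (simp only: raw_disjoint_union_def fst_conv image_Un image_comp hL hR)
  moreover have "image_mset (map_uprod h) (snd (raw_disjoint_union G H)) = snd K"
    using E by (simp add: raw_disjoint_union_def multiset.map_comp map_uprod_comp' hL hR)
  ultimately show ?thesis
    unfolding multigraph_iso_def bij_betw_def
    by (intro conjI exI[of _ h] is_multigraph_disjoint_union assms(1-3))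
qed

instantiation multigraph :: comm_monoid_add
begin

lift_definition zero_multigraph :: multigraph is "({}, {#})"
  by (rule multigraph_iso_refl[OF is_multigraph_empty])

lift_definition plus_multigraph :: "multigraph \<Rightarrow> multigraph \<Rightarrow> multigraph" is raw_disjoint_union
proof -
  fix G G' H H' assume 1: "multigraph_iso G G'" and 2: "multigraph_iso H H'"
  obtain f where f: "bij_betw f (fst G) (fst G')" "image_mset (map_uprod f) (snd G) = snd G'"
    using 1 unfolding multigraph_iso_def by blast
  obtain g where g: "bij_betw g (fst H) (fst H')" "image_mset (map_uprod g) (snd H) = snd H'"
    using 2 unfolding multigraph_iso_def by blast
  show "multigraph_iso (raw_disjoint_union G H) (raw_disjoint_union G' H')"
  proof (rule iso_from_disjoint_union[where f = "sum_encode \<circ> Inl \<circ> f" and g = "sum_encode \<circ> Inr \<circ> g"])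
    show "is_multigraph (raw_disjoint_union G' H')"
      using 1 2 is_multigraph_disjoint_union unfolding multigraph_iso_def by blast
    show "inj_on (sum_encode \<circ> Inl \<circ> f) (fst G)" "inj_on (sum_encode \<circ> Inr \<circ> g) (fst H)"
      using f g by (auto intro!: comp_inj_on inj_encode simp: bij_betw_def)
    show "(sum_encode \<circ> Inl \<circ> f) ` fst G \<inter> (sum_encode \<circ> Inr \<circ> g) ` fst H = {}"
      by (auto simp: sum_encode_eq)
    show "(sum_encode \<circ> Inl \<circ> f) ` fst G \<union> (sum_encode \<circ> Inr \<circ> g) ` fst H = fst (raw_disjoint_union G' H')"
      using f(1) g(1) by (simp add: raw_disjoint_union_def bij_betw_def del: comp_apply) (metis image_comp)
    show "image_mset (map_uprod (sum_encode \<circ> Inl \<circ> f)) (snd G) +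
      image_mset (map_uprod (sum_encode \<circ> Inr \<circ> g)) (snd H) = snd (raw_disjoint_union G' H')"
      by (simp add: raw_disjoint_union_def multiset.map_comp map_uprod_comp' comp_assoc flip: f(2) g(2))
  qed (use 1 2 in \<open>auto simp: multigraph_iso_def\<close>)
qed

instance
proof
  fix a b c :: multigraph
  show "a + b + c = a + (b + c)"
  proof (transfer, clarify)
    fix V V' V'' E E' E''
    define G H K where "G = (V :: nat set, E :: nat uprod multiset)"
      and "H = (V' :: nat set, E' :: nat uprod multiset)"
      and "K = (V'' :: nat set, E'' :: nat uprod multiset)"
    let ?f = "\<lambda>x. (case sum_decode x of Inl x \<Rightarrow> sum_encode (Inl x)
        | Inr y \<Rightarrow> sum_encode (Inr (sum_encode (Inl y))))"
    let ?g = "\<lambda>y. sum_encode (Inr (sum_encode (Inr y)))"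
    assume "multigraph_iso (V, E) (V, E)" "multigraph_iso (V', E') (V', E')"
      "multigraph_iso (V'', E'') (V'', E'')"
    hence *: "is_multigraph G" "is_multigraph H" "is_multigraph K"
      by (auto simp: multigraph_iso_def G_def H_def K_def)
    have "multigraph_iso (raw_disjoint_union (raw_disjoint_union G H) K)
            (raw_disjoint_union G (raw_disjoint_union H K))"
    proof (rule iso_from_disjoint_union[where f = ?f and g = ?g])
      show "inj_on ?f (fst (raw_disjoint_union G H))"
        by (auto simp: inj_on_def raw_disjoint_union_def sum_encode_eq)
      show "inj_on ?g (fst K)" by (auto simp: inj_on_def sum_encode_eq)
      show "?f ` fst (raw_disjoint_union G H) \<inter> ?g ` fst K = {}"
        by (auto simp: raw_disjoint_union_def sum_encode_eq)
      show "?f ` fst (raw_disjoint_union G H) \<union> ?g ` fst K =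
          fst (raw_disjoint_union G (raw_disjoint_union H K))"
        by (simp add: raw_disjoint_union_def image_Un image_image Un_assoc)
      show "image_mset (map_uprod ?f) (snd (raw_disjoint_union G H)) + image_mset (map_uprod ?g) (snd K)
          = snd (raw_disjoint_union G (raw_disjoint_union H K))"
        by (simp add: raw_disjoint_union_def multiset.map_comp map_uprod_comp' add.assoc) (simp add: comp_def)
    qed (use * in \<open>auto intro: is_multigraph_disjoint_union\<close>)
    thus "multigraph_iso (raw_disjoint_union (raw_disjoint_union (V, E) (V', E')) (V'', E''))
            (raw_disjoint_union (V, E) (raw_disjoint_union (V', E') (V'', E'')))"
      by (simp add: G_def H_def K_def)
  qed
  show "a + b = b + a"
  proof (transfer, clarify)
    fix V V' E E'
    define G H where "G = (V :: nat set, E :: nat uprod multiset)"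
      and "H = (V' :: nat set, E' :: nat uprod multiset)"
    assume "multigraph_iso (V, E) (V, E)" "multigraph_iso (V', E') (V', E')"
    hence *: "is_multigraph G" "is_multigraph H"
      by (auto simp: multigraph_iso_def G_def H_def)
    have "multigraph_iso (raw_disjoint_union G H) (raw_disjoint_union H G)"
    proof (rule iso_from_disjoint_union[where f = "sum_encode \<circ> Inr" and g = "sum_encode \<circ> Inl"])
      show "(sum_encode \<circ> Inr) ` fst G \<inter> (sum_encode \<circ> Inl) ` fst H = {}"
        by (auto simp: sum_encode_eq)
      show "is_multigraph (raw_disjoint_union H G)"
        using * by (intro is_multigraph_disjoint_union)
    qed (use * in \<open>auto simp: raw_disjoint_union_def inj_encode\<close>)
    thus "multigraph_iso (raw_disjoint_union (V, E) (V', E')) (raw_disjoint_union (V', E') (V, E))"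
      by (simp add: G_def H_def)
  qed
  show "0 + a = a"
  proof (transfer, clarify)
    fix V E assume "multigraph_iso (V, E) (V, E)"
    hence "is_multigraph (V, E)" by (simp add: multigraph_iso_def)
    thus "multigraph_iso (raw_disjoint_union ({}, {#}) (V, E)) (V, E)"
      by (intro iso_from_disjoint_union[where f = "\<lambda>x. x" and g = "\<lambda>x. x"])
        (auto simp: is_multigraph_empty map_uprod_ident)
  qed
qed

end

text \<open>The algebra of quantum graphs.\<close>

type_synonym quantum_graph = "multigraph \<Rightarrow>\<^sub>0 complex"


section \<open>Homomorphism densities\<close>

text \<open>The value \<open>W (x\<^sub>i, x\<^sub>j)\<close> at an edge \<open>e = ij\<close>; for symmetric \<open>W\<close> it does not depend on
  the order of \<open>i\<close> and \<open>j\<close>.\<close>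

definition edge_value :: "(real \<times> real \<Rightarrow> real) \<Rightarrow> (nat \<Rightarrow> real) \<Rightarrow> nat uprod \<Rightarrow> real" where
  "edge_value W x e = (THE c. \<exists>i j. e = Upair i j \<and> c = W (x i, x j))"

lemma edge_value_Upair:
  assumes "W (x i, x j) = W (x j, x i)"
  shows "edge_value W x (Upair i j) = W (x i, x j)"
  unfolding edge_value_def using assms by (intro the_equality) auto

lemma edge_value_map_uprod: "edge_value W x (map_uprod f e) = edge_value W (x \<circ> f) e"
proof -
  obtain i j where "e = Upair i j" by (cases e)
  hence "(\<exists>i' j'. map_uprod f e = Upair i' j' \<and> c = W (x i', x j')) \<longleftrightarrow>
        (\<exists>i j. e = Upair i j \<and> c = W ((x \<circ> f) i, (x \<circ> f) j))" for c
    by auto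
  thus ?thesis by (simp add: edge_value_def)
qed

lemma edge_value_cong:
  assumes "\<And>i. i \<in> set_uprod e \<Longrightarrow> x i = y i"
  shows "edge_value W x e = edge_value W y e"
proof -
  have "e = Upair i j \<and> c = W (x i, x j) \<longleftrightarrow> e = Upair i j \<and> c = W (y i, y j)" for c i j
    using assms by auto
  thus ?thesis by (simp add: edge_value_def)
qed

text \<open>Lebesgue measure on \<open>[0,1]\<^sup>V\<close>. The completion is needed because kernels are only
  Lebesgue measurable.\<close>

definition cube_measure :: "nat set \<Rightarrow> (nat \<Rightarrow> real) measure" where
  "cube_measure V = completion (\<Pi>\<^sub>M i\<in>V. restrict_space lborel {0..1})"

definition raw_density :: "raw_multigraph \<Rightarrow> (real \<times> real \<Rightarrow> real) \<Rightarrow> real" where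
  "raw_density G W = (\<integral>x. (\<Prod>e\<in>#snd G. edge_value W x e) \<partial>cube_measure (fst G))"

lemma prob_space_unit_interval: "prob_space (restrict_space lborel {0..1::real})"
  by (rule prob_spaceI) (simp add: space_restrict_space emeasure_restrict_space)

lemma measurable_reindex_cube:
  assumes "bij_betw f A B"
  shows "(\<lambda>x. \<lambda>i\<in>A. x (f i)) \<in> measurable (cube_measure B) (cube_measure A)"
    and "distr (cube_measure B) (cube_measure A) (\<lambda>x. \<lambda>i\<in>A. x (f i)) = cube_measure A"
proof -
  let ?P = "\<lambda>A. (\<Pi>\<^sub>M i\<in>A. restrict_space lborel {0..1::real}) :: (nat \<Rightarrow> real) measure"
  let ?t = "\<lambda>x. \<lambda>i\<in>A. x (f i) :: real"
  have m: "?t \<in> measurable (?P B) (?P A)"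
    using assms by (intro measurable_restrict measurable_component_singleton) (auto simp: bij_betw_def)
  hence m': "?t \<in> measurable (completion (?P B)) (?P A)" by (rule measurable_completion)
  have "distr (?P B) (?P A) ?t = ?P A"
    using assms prob_space_unit_interval
    by (intro distr_PiM_reindex) (auto simp: bij_betw_def)
  hence d: "distr (completion (?P B)) (?P A) ?t = ?P A"
    using distr_completion[OF m] by simp
  show "?t \<in> measurable (cube_measure B) (cube_measure A)"
    unfolding cube_measure_def by (rule completion.measurable_completion2[OF m']) (simp add: d)
  show "distr (cube_measure B) (cube_measure A) ?t = cube_measure A"
    unfolding cube_measure_def using completion.completion_distr_eq[OF m'] d by simp
qed

lemma space_cube_measure: "space (cube_measure A) = A \<rightarrow>\<^sub>E {0..1}"
  by (simp add: cube_measure_def space_PiM space_restrict_space)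

lemma integral_reindex_cube:
  fixes h :: "(nat \<Rightarrow> real) \<Rightarrow> real"
  assumes f: "bij_betw f A B"
  shows "(\<integral>x. h (\<lambda>i\<in>A. x (f i)) \<partial>cube_measure B) = (\<integral>x. h x \<partial>cube_measure A)"
proof (cases "h \<in> borel_measurable (cube_measure A)")
  case True
  thus ?thesis
    using integral_distr[OF measurable_reindex_cube(1)[OF f] True] measurable_reindex_cube(2)[OF f]
    by simp
next
  case False
  let ?g = "inv_into A f"
  have "(\<lambda>x. h (\<lambda>i\<in>A. x (f i))) \<notin> borel_measurable (cube_measure B)"
  proof
    assume "(\<lambda>x. h (\<lambda>i\<in>A. x (f i))) \<in> borel_measurable (cube_measure B)"
    with measurable_reindex_cube(1)[OF bij_betw_inv_into[OF f]]
    have *: "(\<lambda>x. h (\<lambda>i\<in>A. (\<lambda>j\<in>B. x (?g j)) (f i))) \<in> borel_measurable (cube_measure A)"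
      by (rule measurable_compose)
    have "(\<lambda>i\<in>A. (\<lambda>j\<in>B. x (?g j)) (f i)) = x" if "x \<in> space (cube_measure A)" for x
    proof
      fix i
      show "(\<lambda>i\<in>A. (\<lambda>j\<in>B. x (?g j)) (f i)) i = x i"
        using PiE_arb[OF that[unfolded space_cube_measure]] bij_betw_apply[OF f] bij_betw_inv_into_left[OF f]
        by (cases "i \<in> A") simp_all
    qed
    hence "h \<in> borel_measurable (cube_measure A)"
      using * by (subst measurable_cong[where g = "\<lambda>x. h (\<lambda>i\<in>A. (\<lambda>j\<in>B. x (?g j)) (f i))"]) simp_all
    thus False using False by contradiction
  qed
  hence "(\<integral>x. h (\<lambda>i\<in>A. x (f i)) \<partial>cube_measure B) = 0"
    by (intro not_integrable_integral_eq notI) (blast dest: borel_measurable_integrable)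
  moreover have "(\<integral>x. h x \<partial>cube_measure A) = 0"
    using False by (intro not_integrable_integral_eq notI) (blast dest: borel_measurable_integrable)
  ultimately show ?thesis by simp
qed

lemma raw_density_iso:
  assumes "multigraph_iso G H" shows "raw_density G = raw_density H"
proof -
  obtain f where f: "bij_betw f (fst G) (fst H)" "image_mset (map_uprod f) (snd G) = snd H"
    and G: "is_multigraph G" using assms unfolding multigraph_iso_def by blast
  have *: "raw_density H W = raw_density G W" for W
  proof -
    have "raw_density H W = (\<integral>x. (\<Prod>e\<in>#snd G. edge_value W (\<lambda>i\<in>fst G. x (f i)) e) \<partial>cube_measure (fst H))"
      unfolding raw_density_def f(2)[symmetric]
    proof (intro Bochner_Integration.integral_cong refl)
      fix x :: "nat \<Rightarrow> real"
      have "edge_value W x (map_uprod f e) = edge_value W (\<lambda>i\<in>fst G. x (f i)) e" if "e \<in># snd G" for e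
        unfolding edge_value_map_uprod
        using that G by (intro edge_value_cong) (auto simp: is_multigraph_def)
      thus "(\<Prod>e\<in>#image_mset (map_uprod f) (snd G). edge_value W x e) =
            (\<Prod>e\<in>#snd G. edge_value W (\<lambda>i\<in>fst G. x (f i)) e)"
        by (simp add: multiset.map_comp comp_def cong: image_mset_cong)
    qed
    also have "\<dots> = raw_density G W"
      unfolding raw_density_def by (rule integral_reindex_cube[OF f(1)])
    finally show ?thesis .
  qed
  show "raw_density G = raw_density H" by (rule ext) (simp add: *)
qed

lift_definition hom_density :: "multigraph \<Rightarrow> (real \<times> real \<Rightarrow> real) \<Rightarrow> real" is raw_density
  by (rule raw_density_iso)

definition quantum_density :: "quantum_graph \<Rightarrow> (real \<times> real \<Rightarrow> real) \<Rightarrow> complex" where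
  "quantum_density g W = (\<Sum>F\<in>Poly_Mapping.keys g. Poly_Mapping.lookup g F * of_real (hom_density F W))"


section \<open>The invariant ring\<close>

text \<open>Polynomials are finitely supported functions from monomials to coefficients. The variable
  \<open>x\<^sub>i\<^sub>j = x\<^sub>j\<^sub>i\<close> is indexed by the unordered pair \<open>Upair i j\<close>, where \<open>i = j\<close> is allowed.\<close>

type_synonym sym_poly = "(nat uprod \<Rightarrow>\<^sub>0 nat) \<Rightarrow>\<^sub>0 complex"

definition Const :: "complex \<Rightarrow> sym_poly" where
  "Const c = Poly_Mapping.single 0 c"

definition Var :: "nat uprod \<Rightarrow> sym_poly" where
  "Var v = Poly_Mapping.single (Poly_Mapping.single v 1) 1"

definition poly_subst :: "(complex \<Rightarrow> 'b) \<Rightarrow> (nat uprod \<Rightarrow> 'b) \<Rightarrow> sym_poly \<Rightarrow> 'b::comm_ring_1" where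
  "poly_subst c f p = (\<Sum>m\<in>Poly_Mapping.keys p. c (Poly_Mapping.lookup p m) *
     (\<Prod>v\<in>Poly_Mapping.keys m. f v ^ Poly_Mapping.lookup m v))"

text \<open>Substitution is a ring homomorphism.\<close>

locale coefficient_hom =
  fixes c :: "complex \<Rightarrow> 'b::comm_ring_1"
  assumes hom_zero: "c 0 = 0" and hom_one: "c 1 = 1"
    and hom_add: "c (a + b) = c a + c b" and hom_mult: "c (a * b) = c a * c b"
begin

lemma poly_subst_add: "poly_subst c f (p + q) = poly_subst c f p + poly_subst c f q"
  unfolding poly_subst_def
  by (rule setsum_keys_plus_distrib) (simp_all add: hom_zero hom_add algebra_simps)

lemma poly_subst_zero [simp]: "poly_subst c f 0 = 0"
  by (simp add: poly_subst_def)

lemma poly_subst_sum: "poly_subst c f (sum g A) = (\<Sum>a\<in>A. poly_subst c f (g a))"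
  by (induction A rule: infinite_finite_induct) (simp_all add: poly_subst_add)

lemma poly_subst_single:
  "poly_subst c f (Poly_Mapping.single m a) =
     c a * (\<Prod>v\<in>Poly_Mapping.keys m. f v ^ Poly_Mapping.lookup m v)"
  by (simp add: poly_subst_def hom_zero)

lemma monomial_value_add:
  fixes m n :: "nat uprod \<Rightarrow>\<^sub>0 nat" and f :: "nat uprod \<Rightarrow> 'b"
  shows "(\<Prod>v\<in>Poly_Mapping.keys (m + n). f v ^ Poly_Mapping.lookup (m + n) v) =
    (\<Prod>v\<in>Poly_Mapping.keys m. f v ^ Poly_Mapping.lookup m v) *
    (\<Prod>v\<in>Poly_Mapping.keys n. f v ^ Poly_Mapping.lookup n v)"
proof -
  let ?K = "Poly_Mapping.keys m \<union> Poly_Mapping.keys n"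
  have *: "(\<Prod>v\<in>Poly_Mapping.keys k. f v ^ Poly_Mapping.lookup k v) =
        (\<Prod>v\<in>?K. f v ^ Poly_Mapping.lookup k v)" if "Poly_Mapping.keys k \<subseteq> ?K" for k
    using that by (intro prod.mono_neutral_left) (auto simp: in_keys_iff)
  show ?thesis
    unfolding *[OF keys_add] *[OF Un_upper1] *[OF Un_upper2]
    by (simp add: lookup_add power_add prod.distrib)
qed

lemma sum_singles: "(\<Sum>m\<in>Poly_Mapping.keys p. Poly_Mapping.single m (Poly_Mapping.lookup p m)) = p"
  by (rule poly_mapping_eqI)
    (simp add: lookup_sum lookup_single when_def sum.delta in_keys_iff cong: if_cong)

lemma poly_subst_mult: "poly_subst c f (p * q) = poly_subst c f p * poly_subst c f q"
proof -
  let ?s = "\<lambda>p m. Poly_Mapping.single m (Poly_Mapping.lookup p m) :: sym_poly"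
  have "p * q = (\<Sum>m\<in>Poly_Mapping.keys p. \<Sum>n\<in>Poly_Mapping.keys q. ?s p m * ?s q n)"
    using sum_product[of "?s p" "Poly_Mapping.keys p" "?s q" "Poly_Mapping.keys q"]
    by (simp add: sum_singles)
  hence "poly_subst c f (p * q) =
      (\<Sum>m\<in>Poly_Mapping.keys p. \<Sum>n\<in>Poly_Mapping.keys q. poly_subst c f (?s p m) * poly_subst c f (?s q n))"
    by (simp add: poly_subst_sum mult_single poly_subst_single monomial_value_add hom_mult mult_ac)
  also have "\<dots> = poly_subst c f p * poly_subst c f q"
    by (simp add: sum_product poly_subst_single) (simp add: poly_subst_def sum_product)
  finally show ?thesis .
qed

lemma poly_subst_one [simp]: "poly_subst c f 1 = 1"
  by (simp add: poly_subst_def hom_one lookup_one)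

lemma poly_subst_prod_mset: "poly_subst c f (\<Prod>x\<in>#M. g x) = (\<Prod>x\<in>#M. poly_subst c f (g x))"
  by (induction M) (simp_all add: poly_subst_mult)

lemma poly_subst_Const: "poly_subst c f (Const a) = c a"
  by (simp add: Const_def poly_subst_single)

lemma poly_subst_Var: "poly_subst c f (Var v) = f v"
  by (simp add: Var_def poly_subst_single hom_one)

end

interpretation eval_hom: coefficient_hom "\<lambda>c. c"
  by unfold_locales simp_all

interpretation Const_hom: coefficient_hom Const
  by unfold_locales (simp_all add: Const_def single_add mult_single flip: single_one)

definition poly_eval :: "(nat uprod \<Rightarrow> complex) \<Rightarrow> sym_poly \<Rightarrow> complex" where
  "poly_eval X = poly_subst (\<lambda>c. c) X"

definition sym_indices :: "nat \<Rightarrow> nat uprod set" where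
  "sym_indices q = {Upair i j |i j. i \<in> {1..q} \<and> j \<in> {1..q}}"

definition polynomials :: "nat \<Rightarrow> sym_poly set" where
  "polynomials q = {p. \<forall>m\<in>Poly_Mapping.keys p. Poly_Mapping.keys m \<subseteq> sym_indices q}"

definition permute_vars :: "(nat \<Rightarrow> nat) \<Rightarrow> sym_poly \<Rightarrow> sym_poly" where
  "permute_vars \<pi> = poly_subst Const (\<lambda>v. Var (map_uprod \<pi> v))"

definition invariants :: "nat \<Rightarrow> sym_poly set" where
  "invariants q = {p \<in> polynomials q. \<forall>\<pi>. \<pi> permutes {1..q} \<longrightarrow> permute_vars \<pi> p = p}"

definition invariant_ring :: "nat \<Rightarrow> sym_poly ring" where
  "invariant_ring q = \<lparr>carrier = invariants q, mult = (*), one = 1, zero = 0, add = (+)\<rparr>"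

lemma polynomials_closed:
  "0 \<in> polynomials q" "1 \<in> polynomials q" "Const a \<in> polynomials q"
  "p \<in> polynomials q \<Longrightarrow> r \<in> polynomials q \<Longrightarrow> p + r \<in> polynomials q"
  "p \<in> polynomials q \<Longrightarrow> r \<in> polynomials q \<Longrightarrow> p * r \<in> polynomials q"
  "v \<in> sym_indices q \<Longrightarrow> Var v \<in> polynomials q"
proof -
  show "0 \<in> polynomials q" "1 \<in> polynomials q" "Const a \<in> polynomials q"
    "v \<in> sym_indices q \<Longrightarrow> Var v \<in> polynomials q"
    by (auto simp: polynomials_def Const_def Var_def)
  show "p + r \<in> polynomials q" if "p \<in> polynomials q" "r \<in> polynomials q"
    using that keys_add[of p r] unfolding polynomials_def by blast
  show "p * r \<in> polynomials q" if "p \<in> polynomials q" "r \<in> polynomials q"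
  proof -
    have "Poly_Mapping.keys m \<subseteq> sym_indices q" if m: "m \<in> Poly_Mapping.keys (p * r)" for m
    proof -
      obtain a b where "m = a + b" "a \<in> Poly_Mapping.keys p" "b \<in> Poly_Mapping.keys r"
        using m keys_mult[of p r] by blast
      thus ?thesis
        using \<open>p \<in> _\<close> \<open>r \<in> _\<close> keys_add[of a b] unfolding polynomials_def by blast
    qed
    thus ?thesis by (simp add: polynomials_def)
  qed
qed

lemma invariants_closed:
  "0 \<in> invariants q" "1 \<in> invariants q" "Const a \<in> invariants q"
  "p \<in> invariants q \<Longrightarrow> r \<in> invariants q \<Longrightarrow> p + r \<in> invariants q"
  "p \<in> invariants q \<Longrightarrow> r \<in> invariants q \<Longrightarrow> p * r \<in> invariants q"
  by (simp_all add: invariants_def polynomials_closed permute_vars_def Const_hom.poly_subst_add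
      Const_hom.poly_subst_mult Const_hom.poly_subst_Const)

lemma cring_invariant_ring: "cring (invariant_ring q)"
proof (rule cringI)
  show "abelian_group (invariant_ring q)"
  proof (rule abelian_groupI)
    fix x assume x: "x \<in> carrier (invariant_ring q)"
    have "Const (-1) * x + x = 0"
    proof -
      have "(Const (-1) + Const 1) * x = 0"
        by (simp flip: Const_hom.hom_add add: Const_hom.hom_zero)
      thus ?thesis by (simp add: Const_hom.hom_one distrib_right)
    qed
    moreover have "Const (-1) * x \<in> invariants q"
      using x by (simp add: invariant_ring_def invariants_closed)
    ultimately show "\<exists>y\<in>carrier (invariant_ring q). y \<oplus>\<^bsub>invariant_ring q\<^esub> x = \<zero>\<^bsub>invariant_ring q\<^esub>"
      by (auto simp: invariant_ring_def)
  qed (auto simp: invariant_ring_def invariants_closed add_ac)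
  show "comm_monoid (invariant_ring q)"
    by (rule comm_monoidI) (auto simp: invariant_ring_def invariants_closed mult_ac)
qed (auto simp: invariant_ring_def algebra_simps)

text \<open>Points of \<open>\<complex>\<close> to the power \<open>q(q+1)/2\<close> are functions on \<open>sym_indices q\<close>, extended by
  \<open>undefined\<close>.\<close>

definition zero_locus :: "nat \<Rightarrow> sym_poly set \<Rightarrow> (nat uprod \<Rightarrow> complex) set" where
  "zero_locus q \<aa> = {X \<in> sym_indices q \<rightarrow>\<^sub>E UNIV. \<forall>h\<in>\<aa>. poly_eval X h = 0}"


section \<open>The map from quantum graphs to invariants\<close>

definition raw_theta :: "nat \<Rightarrow> raw_multigraph \<Rightarrow> sym_poly" where
  "raw_theta q G = Const (1 / of_nat q ^ card (fst G)) *
     (\<Sum>\<phi> \<in> fst G \<rightarrow>\<^sub>E {1..q}. \<Prod>e\<in>#snd G. Var (map_uprod \<phi> e))"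

lemma raw_theta_iso:
  assumes "multigraph_iso G H" shows "raw_theta q G = raw_theta q H"
proof -
  obtain f where f: "bij_betw f (fst G) (fst H)" "image_mset (map_uprod f) (snd G) = snd H"
    and G: "is_multigraph G" using assms unfolding multigraph_iso_def by blast
  have "(\<Sum>\<phi> \<in> fst H \<rightarrow>\<^sub>E {1..q}. \<Prod>e\<in>#snd H. Var (map_uprod \<phi> e)) =
        (\<Sum>\<phi> \<in> fst G \<rightarrow>\<^sub>E {1..q}. \<Prod>e\<in>#snd G. Var (map_uprod \<phi> e))"
  proof (rule sum.reindex_bij_witness[where
        j = "\<lambda>\<phi>. \<lambda>x\<in>fst G. \<phi> (f x)" and i = "\<lambda>\<phi>. \<lambda>y\<in>fst H. \<phi> (inv_into (fst G) f y)"])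
    fix \<phi> assume \<phi>: "\<phi> \<in> fst H \<rightarrow>\<^sub>E {1..q}"
    show "(\<lambda>y\<in>fst H. (\<lambda>x\<in>fst G. \<phi> (f x)) (inv_into (fst G) f y)) = \<phi>"
    proof
      fix y show "(\<lambda>y\<in>fst H. (\<lambda>x\<in>fst G. \<phi> (f x)) (inv_into (fst G) f y)) y = \<phi> y"
        using bij_betw_apply[OF bij_betw_inv_into[OF f(1)]] bij_betw_inv_into_right[OF f(1)]
        by (cases "y \<in> fst H") (simp_all add: PiE_arb[OF \<phi>])
    qed
    show "(\<lambda>x\<in>fst G. \<phi> (f x)) \<in> fst G \<rightarrow>\<^sub>E {1..q}"
      using PiE_mem[OF \<phi> bij_betw_apply[OF f(1)]] by simp
    have "map_uprod \<phi> (map_uprod f e) = map_uprod (\<lambda>x\<in>fst G. \<phi> (f x)) e" if "e \<in># snd G" for e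
      unfolding map_uprod_comp
      using that G by (intro map_uprod_cong_on) (auto simp: is_multigraph_def)
    thus "(\<Prod>e\<in>#snd G. Var (map_uprod (\<lambda>x\<in>fst G. \<phi> (f x)) e)) = (\<Prod>e\<in>#snd H. Var (map_uprod \<phi> e))"
      unfolding f(2)[symmetric] by (simp add: multiset.map_comp comp_def cong: image_mset_cong)
  next
    fix \<phi> assume \<phi>: "\<phi> \<in> fst G \<rightarrow>\<^sub>E {1..q}"
    show "(\<lambda>x\<in>fst G. (\<lambda>y\<in>fst H. \<phi> (inv_into (fst G) f y)) (f x)) = \<phi>"
    proof
      fix x show "(\<lambda>x\<in>fst G. (\<lambda>y\<in>fst H. \<phi> (inv_into (fst G) f y)) (f x)) x = \<phi> x"
        using bij_betw_apply[OF f(1)] bij_betw_inv_into_left[OF f(1)]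
        by (cases "x \<in> fst G") (simp_all add: PiE_arb[OF \<phi>])
    qed
    show "(\<lambda>y\<in>fst H. \<phi> (inv_into (fst G) f y)) \<in> fst H \<rightarrow>\<^sub>E {1..q}"
      using PiE_mem[OF \<phi> bij_betw_apply[OF bij_betw_inv_into[OF f(1)]]] by simp
  qed
  thus ?thesis
    using bij_betw_same_card[OF f(1)] by (simp add: raw_theta_def)
qed

lemma raw_theta_in_invariants:
  assumes G: "is_multigraph G"
  shows "raw_theta q G \<in> invariants q"
proof -
  define S where "S = (\<Sum>\<phi> \<in> fst G \<rightarrow>\<^sub>E {1..q}. \<Prod>e\<in>#snd G. Var (map_uprod \<phi> e))"
  have index: "map_uprod \<phi> e \<in> sym_indices q"
    if "\<phi> \<in> fst G \<rightarrow>\<^sub>E {1..q}" "e \<in># snd G" for \<phi> e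
  proof (cases e)
    case (Upair i j)
    hence "i \<in> fst G" "j \<in> fst G" using that(2) G by (force simp: is_multigraph_def)+
    hence "\<phi> i \<in> {1..q}" "\<phi> j \<in> {1..q}" using that(1) by (blast intro: PiE_mem)+
    thus ?thesis unfolding Upair map_uprod_simps sym_indices_def by blast
  qed
  have "(\<Prod>e\<in>#M. Var (h e)) \<in> polynomials q" if "\<And>e. e \<in># M \<Longrightarrow> h e \<in> sym_indices q"
    for M :: "nat uprod multiset" and h
    using that by (induction M) (simp_all add: polynomials_closed)
  hence prod: "(\<Prod>e\<in>#snd G. Var (map_uprod \<phi> e)) \<in> polynomials q" if "\<phi> \<in> fst G \<rightarrow>\<^sub>E {1..q}" for \<phi>
    using index[OF that] by blast
  have sum: "sum h A \<in> polynomials q" if "\<And>a. a \<in> A \<Longrightarrow> h a \<in> polynomials q"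
    for h :: "(nat \<Rightarrow> nat) \<Rightarrow> sym_poly" and A
    using that by (induction A rule: infinite_finite_induct) (simp_all add: polynomials_closed)
  have S_poly: "S \<in> polynomials q" unfolding S_def by (rule sum) (rule prod)
  have "permute_vars \<pi> S = S" if \<pi>: "\<pi> permutes {1..q}" for \<pi>
  proof -
    have "permute_vars \<pi> S = (\<Sum>\<phi> \<in> fst G \<rightarrow>\<^sub>E {1..q}. \<Prod>e\<in>#snd G. Var (map_uprod (\<pi> \<circ> \<phi>) e))"
      by (simp add: S_def permute_vars_def Const_hom.poly_subst_sum Const_hom.poly_subst_prod_mset
          Const_hom.poly_subst_Var map_uprod_comp)
    also have "\<dots> = S"
      unfolding S_def
    proof (rule sum.reindex_bij_witness[where
          j = "\<lambda>\<phi>. \<lambda>x\<in>fst G. \<pi> (\<phi> x)" and i = "\<lambda>\<phi>. \<lambda>x\<in>fst G. inv_into UNIV \<pi> (\<phi> x)"])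
      fix \<phi> assume \<phi>: "\<phi> \<in> fst G \<rightarrow>\<^sub>E {1..q}"
      show "(\<lambda>x\<in>fst G. inv_into UNIV \<pi> ((\<lambda>x\<in>fst G. \<pi> (\<phi> x)) x)) = \<phi>"
      proof
        fix x show "(\<lambda>x\<in>fst G. inv_into UNIV \<pi> ((\<lambda>x\<in>fst G. \<pi> (\<phi> x)) x)) x = \<phi> x"
          using permutes_inverses(2)[OF \<pi>] by (cases "x \<in> fst G") (simp_all add: PiE_arb[OF \<phi>])
      qed
      show "(\<lambda>x\<in>fst G. \<pi> ((\<lambda>x\<in>fst G. inv_into UNIV \<pi> (\<phi> x)) x)) = \<phi>"
      proof
        fix x show "(\<lambda>x\<in>fst G. \<pi> ((\<lambda>x\<in>fst G. inv_into UNIV \<pi> (\<phi> x)) x)) x = \<phi> x"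
          using permutes_inverses(1)[OF \<pi>] by (cases "x \<in> fst G") (simp_all add: PiE_arb[OF \<phi>])
      qed
      show "(\<lambda>x\<in>fst G. \<pi> (\<phi> x)) \<in> fst G \<rightarrow>\<^sub>E {1..q}"
        using PiE_mem[OF \<phi>] permutes_in_image[OF \<pi>] by (simp del: atLeastAtMost_iff)
      show "(\<lambda>x\<in>fst G. inv_into UNIV \<pi> (\<phi> x)) \<in> fst G \<rightarrow>\<^sub>E {1..q}"
        using PiE_mem[OF \<phi>] permutes_in_image[OF permutes_inv[OF \<pi>]] by (simp del: atLeastAtMost_iff)
      have "map_uprod (\<lambda>x\<in>fst G. \<pi> (\<phi> x)) e = map_uprod (\<pi> \<circ> \<phi>) e" if "e \<in># snd G" for e
        using that G by (intro map_uprod_cong_on) (auto simp: is_multigraph_def)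
      thus "(\<Prod>e\<in>#snd G. Var (map_uprod (\<lambda>x\<in>fst G. \<pi> (\<phi> x)) e)) =
            (\<Prod>e\<in>#snd G. Var (map_uprod (\<pi> \<circ> \<phi>) e))"
        by (simp cong: image_mset_cong)
    qed
    finally show ?thesis .
  qed
  with S_poly have "S \<in> invariants q" by (simp add: invariants_def)
  thus ?thesis unfolding raw_theta_def S_def[symmetric] by (intro invariants_closed)
qed

lift_definition graph_theta :: "nat \<Rightarrow> multigraph \<Rightarrow> sym_poly" is raw_theta
  by (rule raw_theta_iso)

definition theta :: "nat \<Rightarrow> quantum_graph \<Rightarrow> sym_poly" where
  "theta q g = (\<Sum>F\<in>Poly_Mapping.keys g. Const (Poly_Mapping.lookup g F) * graph_theta q F)"

lemma theta_in_invariants: "theta q g \<in> invariants q"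
proof -
  have "graph_theta q F \<in> invariants q" for F
    by transfer (simp add: raw_theta_in_invariants multigraph_iso_def)
  hence mult: "Const a * graph_theta q F \<in> invariants q" for a F
    by (intro invariants_closed)
  have sum: "sum h A \<in> invariants q" if "\<And>a. a \<in> A \<Longrightarrow> h a \<in> invariants q"
    for h :: "multigraph \<Rightarrow> sym_poly" and A
    using that by (induction A rule: infinite_finite_induct) (simp_all add: invariants_closed)
  show ?thesis unfolding theta_def by (rule sum) (rule mult)
qed


section \<open>Varieties and vanishing ideals\<close>

definition kernel_variety :: "(real \<times> real \<Rightarrow> real) set \<Rightarrow> quantum_graph set \<Rightarrow> (real \<times> real \<Rightarrow> real) set" where
  "kernel_variety \<Omega> Q = {W \<in> \<Omega>. \<forall>g\<in>Q. quantum_density g W = 0}"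

definition vanishing_ideal :: "(real \<times> real \<Rightarrow> real) set \<Rightarrow> quantum_graph set" where
  "vanishing_ideal Y = {g. \<forall>W\<in>Y. quantum_density g W = 0}"

definition kernel_variety_at ::
  "(real \<times> real \<Rightarrow> real) set \<Rightarrow> nat \<Rightarrow> sym_poly set \<Rightarrow> (real \<times> real \<Rightarrow> real) set" where
  "kernel_variety_at \<Omega> q \<aa> = kernel_variety \<Omega> (theta q -` \<aa>)"

definition vanishing_ideal_at :: "nat \<Rightarrow> (real \<times> real \<Rightarrow> real) set \<Rightarrow> sym_poly set" where
  "vanishing_ideal_at q Y = theta q ` vanishing_ideal Y"

end

theory Submission
  imports Defs "HOL-Computational_Algebra.Fundamental_Theorem_Algebra"
begin

text \<open>By the Nullstellensatz a power of \<open>theta q g\<close> lies in the ideal of the full polynomial ring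
  generated by \<open>\<aa>\<close>, and averaging over the symmetric group brings it back into \<open>\<aa>\<close>. Both \<open>theta q\<close>
  and the density are multiplicative, so a power of \<open>g\<close>, hence \<open>g\<close> itself, has density zero on the variety.

  Since \<open>\<complex>\<close> is uncountable, the Nullstellensatz needs neither Noetherianity nor field extensions:
  modulo an ideal \<open>P\<close> that is maximal among those containing no power of \<open>f\<close>, every variable is
  congruent to a constant, and these constants form a common zero of \<open>P\<close> at which \<open>f\<close> does not vanish.\<close>

section \<open>Multiplicativity of the density and of \<open>theta\<close>\<close>

text \<open>Independence means that the joint law is the product of the marginals. The joint map of
  the coordinates is the identity on the product space, so its law is \<open>PiM I M\<close> by
  construction. The characterisation by laws assumes a nonempty index set, hence the case
  split.\<close>

lemma indep_vars_coordinates: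
  assumes M: "\<And>i. i \<in> I \<Longrightarrow> prob_space (M i)"
  shows "prob_space.indep_vars (PiM I M) M (\<lambda>i \<omega>. \<omega> i) I"
proof -
  interpret prob_space "PiM I M" using M by (rule prob_space_PiM)
  show ?thesis
  proof (cases "I = {}")
    case True
    thus ?thesis unfolding indep_vars_def indep_sets_def by auto
  next
    case False
    have "distr (PiM I M) (PiM I M) (\<lambda>x. \<lambda>i\<in>I. x i) = distr (PiM I M) (PiM I M) (\<lambda>x. x)"
      by (intro distr_cong refl) (simp add: space_PiM PiE_def extensional_restrict)
    also have "\<dots> = (\<Pi>\<^sub>M i\<in>I. distr (PiM I M) (M i) (\<lambda>\<omega>. \<omega> i))"
      using M by (simp add: distr_PiM_component cong: PiM_cong)
    finally show ?thesis
      using False by (subst indep_vars_iff_distr_eq_PiM') (simp_all cong: PiM_cong)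
  qed
qed

section \<open>Integration over completed cubes\<close>

abbreviation unit_lborel :: "real measure" where
  "unit_lborel \<equiv> restrict_space lborel {0..1}"

abbreviation cube_lborel :: "nat set \<Rightarrow> (nat \<Rightarrow> real) measure" where
  "cube_lborel A \<equiv> \<Pi>\<^sub>M i\<in>A. unit_lborel"

lemma prob_space_cube_lborel: "prob_space (cube_lborel A)"
  by (intro prob_space_PiM prob_space_unit_interval)

text \<open>Restriction pushes the measure of the larger cube forward to that of the smaller one.
  Preimages of null sets are therefore null, which is what carries measurability over to the
  completions.\<close>

lemma measurable_cube_restrict:
  assumes "A \<subseteq> B"
  shows "(\<lambda>x. restrict x A) \<in> cube_lborel B \<rightarrow>\<^sub>M cube_lborel A"
    and "distr (cube_lborel B) (cube_lborel A) (\<lambda>x. restrict x A) = cube_lborel A"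
    and "(\<lambda>x. restrict x A) \<in> cube_measure B \<rightarrow>\<^sub>M cube_measure A"
proof -
  show m: "(\<lambda>x. restrict x A) \<in> cube_lborel B \<rightarrow>\<^sub>M cube_lborel A"
    using assms by (rule measurable_restrict_subset)
  have "distr (cube_lborel B) (cube_lborel A) (\<lambda>\<omega>. \<lambda>n\<in>A. \<omega> n) = cube_lborel A"
    using assms by (intro distr_PiM_reindex[where f = "\<lambda>x. x"] prob_space_unit_interval) auto
  thus d: "distr (cube_lborel B) (cube_lborel A) (\<lambda>x. restrict x A) = cube_lborel A"
    by simp
  show "(\<lambda>x. restrict x A) \<in> cube_measure B \<rightarrow>\<^sub>M cube_measure A"
    unfolding cube_measure_def
    by (rule completion.measurable_completion2[OF measurable_completion[OF m]])
      (simp add: distr_completion[OF m] d)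
qed

lemma AE_cube_restrict:
  assumes "A \<subseteq> B" "AE y in cube_lborel A. P y"
  shows "AE x in cube_lborel B. P (restrict x A)"
  using assms(2)
  by (intro AE_distrD[OF measurable_cube_restrict(1)[OF assms(1)]])
    (simp only: measurable_cube_restrict(2)[OF assms(1)])

lemma integral_cube_restrict:
  fixes f :: "(nat \<Rightarrow> real) \<Rightarrow> real"
  assumes "A \<subseteq> B" "f \<in> borel_measurable (cube_lborel A)"
  shows "(\<integral>x. f (restrict x A) \<partial>cube_lborel B) = (\<integral>x. f x \<partial>cube_lborel A)"
    and "integrable (cube_lborel A) f \<Longrightarrow> integrable (cube_lborel B) (\<lambda>x. f (restrict x A))"
  using integral_distr[OF measurable_cube_restrict(1)[OF assms(1)] assms(2)]
    integrable_distr[OF measurable_cube_restrict(1)[OF assms(1)], of f]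
  by (simp_all add: measurable_cube_restrict(2)[OF assms(1)])

text \<open>The completion of a product measure is in general not the product of the completions, so
  both factors are first replaced, up to null sets, by functions measurable for the uncompleted
  cubes. These depend on disjoint sets of coordinates, hence are independent random variables, and
  the expectation of their product factors.\<close>

lemma integral_cube_product:
  fixes f g :: "(nat \<Rightarrow> real) \<Rightarrow> real"
  assumes disj: "A \<inter> B = {}"
    and f: "integrable (cube_measure A) f" and g: "integrable (cube_measure B) g"
  shows "(\<integral>x. f (restrict x A) * g (restrict x B) \<partial>cube_measure (A \<union> B)) =
    (\<integral>x. f x \<partial>cube_measure A) * (\<integral>x. g x \<partial>cube_measure B)"
proof -
  interpret prob_space "cube_lborel (A \<union> B)" by (rule prob_space_cube_lborel)
  have mod: "\<exists>h'\<in>borel_measurable (cube_lborel C). (AE x in cube_lborel C. h x = h' x) \<and>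
      integrable (cube_lborel C) h' \<and> (\<integral>x. h x \<partial>cube_measure C) = (\<integral>x. h' x \<partial>cube_lborel C)"
    if h: "integrable (cube_measure C) h" for C and h :: "(nat \<Rightarrow> real) \<Rightarrow> real"
  proof -
    have hm: "h \<in> borel_measurable (cube_measure C)" using h by (rule borel_measurable_integrable)
    then obtain h' where h': "h' \<in> borel_measurable (cube_lborel C)"
      and ae: "AE x in cube_lborel C. h x = h' x"
      unfolding cube_measure_def using completion_ex_borel_measurable_real by metis
    have h'm: "h' \<in> borel_measurable (cube_measure C)"
      unfolding cube_measure_def using h' by (rule measurable_completion)
    have ae': "AE x in cube_measure C. h x = h' x"
      unfolding cube_measure_def using ae by (rule AE_completion)
    have "integrable (cube_measure C) h'"
      using h integrable_cong_AE[OF hm h'm ae'] by simp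
    moreover have "(\<integral>x. h x \<partial>cube_measure C) = (\<integral>x. h' x \<partial>cube_measure C)"
      by (rule integral_cong_AE[OF hm h'm ae'])
    ultimately show ?thesis
      using h' ae unfolding cube_measure_def
      by (auto simp: integrable_completion integral_completion)
  qed
  obtain f' where f': "f' \<in> borel_measurable (cube_lborel A)" "AE x in cube_lborel A. f x = f' x"
      "integrable (cube_lborel A) f'" "(\<integral>x. f x \<partial>cube_measure A) = (\<integral>x. f' x \<partial>cube_lborel A)"
    using mod[OF f] by blast
  obtain g' where g': "g' \<in> borel_measurable (cube_lborel B)" "AE x in cube_lborel B. g x = g' x"
      "integrable (cube_lborel B) g'" "(\<integral>x. g x \<partial>cube_measure B) = (\<integral>x. g' x \<partial>cube_lborel B)"
    using mod[OF g] by blast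
  have ind: "indep_var borel (f' \<circ> (\<lambda>\<omega>. restrict \<omega> A)) borel (g' \<circ> (\<lambda>\<omega>. restrict \<omega> B))"
    using indep_var_restrict[OF indep_vars_coordinates[OF prob_space_unit_interval] disj] f'(1) g'(1)
    by (intro indep_var_compose) auto
  let ?h = "\<lambda>x. f (restrict x A) * g (restrict x B)" and ?h' = "\<lambda>x. f' (restrict x A) * g' (restrict x B)"
  have ae: "AE x in cube_lborel (A \<union> B). ?h x = ?h' x"
    using AE_cube_restrict[OF Un_upper1 f'(2)] AE_cube_restrict[OF Un_upper2 g'(2)] by eventually_elim simp
  have h': "?h' \<in> borel_measurable (cube_lborel (A \<union> B))"
    using measurable_compose[OF measurable_restrict_subset[OF Un_upper1] f'(1)]
      measurable_compose[OF measurable_restrict_subset[OF Un_upper2] g'(1)]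
    by (rule borel_measurable_times)
  have "(\<integral>x. ?h x \<partial>cube_measure (A \<union> B)) = (\<integral>x. ?h' x \<partial>cube_measure (A \<union> B))"
  proof (rule integral_cong_AE)
    show "?h' \<in> borel_measurable (cube_measure (A \<union> B))"
      unfolding cube_measure_def using h' by (rule measurable_completion)
    show "AE x in cube_measure (A \<union> B). ?h x = ?h' x"
      unfolding cube_measure_def using ae by (rule AE_completion)
    show "?h \<in> borel_measurable (cube_measure (A \<union> B))"
      using measurable_compose[OF measurable_cube_restrict(3)[OF Un_upper1] borel_measurable_integrable[OF f]]
        measurable_compose[OF measurable_cube_restrict(3)[OF Un_upper2] borel_measurable_integrable[OF g]]
      by (rule borel_measurable_times)
  qed
  also have "\<dots> = (\<integral>x. ?h' x \<partial>cube_lborel (A \<union> B))"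
    unfolding cube_measure_def using h' by (rule integral_completion)
  also have "\<dots> = (\<integral>x. f' (restrict x A) \<partial>cube_lborel (A \<union> B)) * (\<integral>x. g' (restrict x B) \<partial>cube_lborel (A \<union> B))"
    using indep_var_lebesgue_integral[OF ind]
      integral_cube_restrict(2)[OF Un_upper1 f'(1,3)] integral_cube_restrict(2)[OF Un_upper2 g'(1,3)]
    by (simp add: comp_def)
  finally show ?thesis
    by (simp add: f'(4) g'(4) integral_cube_restrict(1)[OF Un_upper1 f'(1)]
        integral_cube_restrict(1)[OF Un_upper2 g'(1)])
qed

text \<open>Since \<open>W\<close> is only Lebesgue measurable, the map to the pair of coordinates
  must pull null sets back to null sets. For distinct indices the coordinates are independent and
  uniform, so the law of the pair is Lebesgue measure on the square. A loop would instead
  concentrate this law on the diagonal, which is a null set.\<close>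

lemma kernel_edge_measurable:
  assumes W: "W \<in> kernels" and ij: "i \<in> A" "j \<in> A" "i \<noteq> j"
  shows "(\<lambda>x. W (x i, x j)) \<in> borel_measurable (cube_measure A)"
proof -
  let ?t = "\<lambda>x :: nat \<Rightarrow> real. (x i, x j)" and ?LL = "unit_lborel \<Otimes>\<^sub>M unit_lborel"
  interpret prob_space "cube_lborel A" by (rule prob_space_cube_lborel)
  interpret L: prob_space unit_lborel by (rule prob_space_unit_interval)
  have id: "(\<lambda>x. x) \<in> unit_lborel \<rightarrow>\<^sub>M borel"
    by (intro measurable_restrict_space1) simp
  have t_LL: "?t \<in> cube_lborel A \<rightarrow>\<^sub>M ?LL"
    using ij by (intro measurable_Pair measurable_component_singleton)
  have "(\<lambda>z. (fst z, snd z)) \<in> ?LL \<rightarrow>\<^sub>M borel \<Otimes>\<^sub>M borel"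
    using measurable_compose[OF measurable_fst id] measurable_compose[OF measurable_snd id]
    by (intro measurable_Pair)
  hence LL_borel: "(\<lambda>z. z) \<in> ?LL \<rightarrow>\<^sub>M (borel :: (real \<times> real) measure)"
    by (simp add: borel_prod)
  have "indep_var (PiM {i} (\<lambda>_. unit_lborel)) (\<lambda>\<omega>. restrict \<omega> {i}) (PiM {j} (\<lambda>_. unit_lborel)) (\<lambda>\<omega>. restrict \<omega> {j})"
    using ij indep_var_restrict[OF indep_vars_coordinates[OF prob_space_unit_interval], of "{i}" "{j}"]
    by simp
  hence "indep_var unit_lborel ((\<lambda>\<omega>. \<omega> i) \<circ> (\<lambda>\<omega>. restrict \<omega> {i})) unit_lborel ((\<lambda>\<omega>. \<omega> j) \<circ> (\<lambda>\<omega>. restrict \<omega> {j}))"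
    by (rule indep_var_compose) (auto intro: measurable_component_singleton)
  hence distr: "distr (cube_lborel A) ?LL ?t = ?LL"
    using ij distr_PiM_component[of A "\<lambda>_. unit_lborel", OF prob_space_unit_interval]
    by (simp add: indep_var_distribution_eq comp_def)
  have t_lborel: "?t \<in> cube_lborel A \<rightarrow>\<^sub>M (lborel :: (real \<times> real) measure)"
    using measurable_compose[OF t_LL LL_borel] by simp
  have t_null: "emeasure (cube_lborel A) (?t -` N \<inter> space (cube_lborel A)) = 0"
    if N: "N \<in> null_sets (lborel :: (real \<times> real) measure)" for N
  proof -
    have [measurable]: "N \<in> sets borel" using N by auto
    have indN: "(indicator N :: real \<times> real \<Rightarrow> ennreal) \<in> borel_measurable ?LL"
      by (rule measurable_compose[OF LL_borel]) simp
    have N2: "N \<in> sets (lborel \<Otimes>\<^sub>M lborel)" unfolding lborel_prod using N by auto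
    have "?t -` N \<inter> space (cube_lborel A) \<in> sets (cube_lborel A)"
      using t_lborel N by (intro measurable_sets) auto
    hence "emeasure (cube_lborel A) (?t -` N \<inter> space (cube_lborel A)) =
        (\<integral>\<^sup>+x. indicator (?t -` N \<inter> space (cube_lborel A)) x \<partial>cube_lborel A)"
      by (rule nn_integral_indicator[symmetric])
    also have "\<dots> = (\<integral>\<^sup>+x. indicator N (?t x) \<partial>cube_lborel A)"
      by (intro nn_integral_cong) (simp add: indicator_def)
    also have "\<dots> = (\<integral>\<^sup>+z. indicator N z \<partial>?LL)"
      using nn_integral_distr[OF t_LL, of "indicator N"] indN by (simp add: distr)
    also have "\<dots> = (\<integral>\<^sup>+a. \<integral>\<^sup>+b. indicator N (a, b) \<partial>unit_lborel \<partial>unit_lborel)"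
      using indN by (simp add: L.nn_integral_fst)
    \<comment> \<open>Enlarging the unit interval to the whole line can only increase the integral
      and turns it into the planar Lebesgue measure of \<open>N\<close>, which is zero.\<close>
    also have "\<dots> \<le> (\<integral>\<^sup>+a. \<integral>\<^sup>+b. indicator N (a, b) \<partial>lborel \<partial>lborel)"
    proof -
      have le: "(\<integral>\<^sup>+a. h a \<partial>unit_lborel) \<le> (\<integral>\<^sup>+a. k a \<partial>lborel)"
        if "\<And>a. h a \<le> k a" for h k :: "real \<Rightarrow> ennreal"
        using that by (subst nn_integral_restrict_space) (auto intro!: nn_integral_mono simp: indicator_def)
      show ?thesis by (intro le) simp
    qed
    also have "\<dots> = emeasure (lborel \<Otimes>\<^sub>M lborel) N"
      using N2 by (rule lborel.emeasure_pair_measure[symmetric])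
    also have "\<dots> = 0" using N by (simp add: lborel_prod null_sets_def)
    finally show ?thesis by simp
  qed
  have "?t \<in> completion (cube_lborel A) \<rightarrow>\<^sub>M lebesgue"
  proof (rule completion.measurable_completion2)
    show t: "?t \<in> completion (cube_lborel A) \<rightarrow>\<^sub>M lborel"
      using t_lborel by (rule measurable_completion)
    show "null_sets lborel \<subseteq> null_sets (distr (completion (cube_lborel A)) lborel ?t)"
      using t_null t_lborel
      by (auto simp: distr_completion[OF t_lborel] null_sets_def emeasure_distr)
  qed
  hence "?t \<in> cube_measure A \<rightarrow>\<^sub>M lebesgue_on ({0..1} \<times> {0..1})"
    using ij unfolding cube_measure_def
    by (intro measurable_restrict_space2) (auto simp: space_PiM space_restrict_space PiE_iff)
  moreover have "W \<in> borel_measurable (lebesgue_on ({0..1} \<times> {0..1}))"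
    using W by (simp add: kernels_def)
  ultimately show ?thesis by (rule measurable_compose)
qed

lemma raw_density_integrable:
  assumes W: "W \<in> kernels" and G: "is_multigraph G"
  shows "integrable (cube_measure (fst G)) (\<lambda>x. \<Prod>e\<in>#snd G. edge_value W x e)"
proof -
  interpret P: prob_space "cube_measure (fst G)"
    unfolding cube_measure_def by (intro prob_space.prob_space_completion prob_space_cube_lborel)
  have sym: "W (a, b) = W (b, a)" if "a \<in> {0..1}" "b \<in> {0..1}" for a b
    using W that by (auto simp: kernels_def)
  have "bounded (W ` ({0..1} \<times> {0..1}))" using W by (simp add: kernels_def)
  then obtain K where "\<forall>w\<in>W ` ({0..1} \<times> {0..1}). norm w \<le> K" unfolding bounded_iff ..
  hence K: "\<bar>W z\<bar> \<le> K" if "z \<in> {0..1} \<times> {0..1}" for z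
    using that by (metis image_eqI real_norm_def)
  \<comment> \<open>The maximum with 1 makes nonnegativity immediate when the bounds for single
    edges are multiplied.\<close>
  define K' where "K' = max 1 K"
  have edge: "(\<lambda>x. edge_value W x e) \<in> borel_measurable (cube_measure (fst G)) \<and>
      (\<forall>x\<in>space (cube_measure (fst G)). \<bar>edge_value W x e\<bar> \<le> K')" if e: "e \<in># snd G" for e
  proof -
    obtain i j where ij: "e = Upair i j" by (cases e)
    have V: "i \<in> fst G" "j \<in> fst G" "i \<noteq> j" using G e by (auto simp: is_multigraph_def ij)
    have x: "x i \<in> {0..1}" "x j \<in> {0..1}" if "x \<in> space (cube_measure (fst G))" for x
      using that V unfolding space_cube_measure by (auto dest: PiE_mem)
    have val: "edge_value W x e = W (x i, x j)" if "x \<in> space (cube_measure (fst G))" for x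
      unfolding ij by (intro edge_value_Upair sym x that)
    show ?thesis
    proof
      show "(\<lambda>x. edge_value W x e) \<in> borel_measurable (cube_measure (fst G))"
        using kernel_edge_measurable[OF W V] by (simp add: val cong: measurable_cong)
      show "\<forall>x\<in>space (cube_measure (fst G)). \<bar>edge_value W x e\<bar> \<le> K'"
        using K x by (auto simp: val K'_def intro!: order_trans[OF K] simp del: atLeastAtMost_iff)
    qed
  qed
  have "(\<lambda>x. \<Prod>e\<in>#M. edge_value W x e) \<in> borel_measurable (cube_measure (fst G)) \<and>
      (\<forall>x\<in>space (cube_measure (fst G)). \<bar>\<Prod>e\<in>#M. edge_value W x e\<bar> \<le> K' ^ size M)"
    if "M \<subseteq># snd G" for M
    using that
  proof (induction M)
    case (add e M)
    have e: "e \<in># snd G" using add.prems by (auto dest: mset_subset_eqD)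
    have "M \<subseteq># snd G" using add.prems by (metis mset_subset_eq_insertD subset_mset.less_imp_le)
    note IH = add.IH[OF this]
    show ?case
      using IH edge[OF e] by (auto simp: abs_mult K'_def intro!: mult_mono borel_measurable_times)
  qed simp_all
  from this[of "snd G"] show ?thesis
    by (intro P.integrable_const_bound[where B = "K' ^ size (snd G)"]) auto
qed

text \<open>Relabelling by the two encodings places the graphs on disjoint vertex sets without
  changing their densities. The integrand for the union is then a product of two functions, each
  depending only on the coordinates of its own part.\<close>

lemma raw_density_disjoint_union:
  assumes W: "W \<in> kernels" and G: "is_multigraph G" and H: "is_multigraph H"
  shows "raw_density (raw_disjoint_union G H) W = raw_density G W * raw_density H W"
proof -
  let ?l = "sum_encode \<circ> Inl" and ?r = "sum_encode \<circ> Inr"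
  let ?G = "(?l ` fst G, image_mset (map_uprod ?l) (snd G))"
  let ?H = "(?r ` fst H, image_mset (map_uprod ?r) (snd H))"
  let ?d = "\<lambda>K x. \<Prod>e\<in>#snd K. edge_value W x e"
  have relabel: "multigraph_iso K (f ` fst K, image_mset (map_uprod f) (snd K))"
    if K: "is_multigraph K" and f: "inj f" for K and f :: "nat \<Rightarrow> nat"
  proof -
    have "is_multigraph (f ` fst K, image_mset (map_uprod f) (snd K))"
      using K f by (fastforce simp: is_multigraph_def set_map_uprod proper_map_uprod inj_on_subset)
    thus ?thesis
      using K inj_on_subset[OF f subset_UNIV]
      unfolding multigraph_iso_def bij_betw_def by (intro conjI exI[of _ f]) simp_all
  qed
  have iso: "multigraph_iso G ?G" "multigraph_iso H ?H"
    using relabel[OF G inj_encode(1)] relabel[OF H inj_encode(2)] .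
  have GH: "is_multigraph ?G" "is_multigraph ?H" using iso unfolding multigraph_iso_def by blast+
  have d_restrict: "?d K x = ?d K (restrict x (fst K))" if "is_multigraph K" for K x
  proof -
    have "edge_value W x e = edge_value W (restrict x (fst K)) e" if "e \<in># snd K" for e
      using that \<open>is_multigraph K\<close> by (intro edge_value_cong) (auto simp: is_multigraph_def)
    thus ?thesis by (simp cong: image_mset_cong)
  qed
  have "raw_density (raw_disjoint_union G H) W =
      (\<integral>x. ?d ?G (restrict x (fst ?G)) * ?d ?H (restrict x (fst ?H)) \<partial>cube_measure (fst ?G \<union> fst ?H))"
    unfolding raw_density_def d_restrict[OF GH(1), symmetric] d_restrict[OF GH(2), symmetric]
    by (simp add: raw_disjoint_union_def)
  also have "\<dots> = raw_density ?G W * raw_density ?H W"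
    unfolding raw_density_def
    by (intro integral_cube_product raw_density_integrable W GH) (auto simp: sum_encode_eq)
  finally show ?thesis by (simp only: raw_density_iso[OF iso(1)] raw_density_iso[OF iso(2)])
qed

lemma hom_density_add:
  assumes "W \<in> kernels"
  shows "hom_density (F + G) W = hom_density F W * hom_density G W"
  using assms by (transfer fixing: W) (simp add: raw_density_disjoint_union multigraph_iso_def)

lemma hom_density_0: "hom_density 0 W = 1"
proof (transfer fixing: W)
  have "prob_space (cube_measure {})"
    unfolding cube_measure_def by (intro prob_space.prob_space_completion prob_space_cube_lborel)
  thus "raw_density ({}, {#}) W = 1" by (simp add: raw_density_def prob_space.prob_space)
qed

text \<open>A map from the union to \<open>{1..q}\<close> is the same as a pair of maps from the two
  parts, so the sum factors. The normalising factor splits because the vertex numbers add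
  up.\<close>

lemma raw_theta_disjoint_union:
  assumes G: "is_multigraph G" and H: "is_multigraph H"
  shows "raw_theta q (raw_disjoint_union G H) = raw_theta q G * raw_theta q H"
proof -
  let ?l = "sum_encode \<circ> Inl" and ?r = "sum_encode \<circ> Inr"
  let ?A = "?l ` fst G" and ?B = "?r ` fst H"
  let ?t = "\<lambda>\<phi> K. \<Prod>e\<in>#snd K. Var (map_uprod \<phi> e)"
  have fin: "finite (fst G)" "finite (fst H)" using G H by (auto simp: is_multigraph_def)
  have card: "card (?A \<union> ?B) = card (fst G) + card (fst H)"
    using fin by (subst card_Un_disjoint) (auto simp: card_image inj_encode sum_encode_eq simp del: comp_apply, auto simp: sum_encode_eq)
  have t: "?t (restrict \<phi> (fst K)) K = ?t \<phi> K" if "is_multigraph K" for \<phi> K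
  proof -
    have "map_uprod (restrict \<phi> (fst K)) e = map_uprod \<phi> e" if "e \<in># snd K" for e
      using that \<open>is_multigraph K\<close> by (intro map_uprod_cong_on) (auto simp: is_multigraph_def)
    thus ?thesis by (simp cong: image_mset_cong)
  qed
  have "(\<Sum>\<phi>\<in>?A \<union> ?B \<rightarrow>\<^sub>E {1..q}. ?t \<phi> (raw_disjoint_union G H)) =
      (\<Sum>(\<alpha>, \<beta>)\<in>(fst G \<rightarrow>\<^sub>E {1..q}) \<times> (fst H \<rightarrow>\<^sub>E {1..q}). ?t \<alpha> G * ?t \<beta> H)"
  proof (rule sum.reindex_bij_witness[where
        j = "\<lambda>\<phi>. (restrict (\<phi> \<circ> ?l) (fst G), restrict (\<phi> \<circ> ?r) (fst H))" and
        i = "\<lambda>(\<alpha>, \<beta>). restrict (case_sum \<alpha> \<beta> \<circ> sum_decode) (?A \<union> ?B)"])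
    fix \<phi> assume \<phi>: "\<phi> \<in> ?A \<union> ?B \<rightarrow>\<^sub>E {1..q}"
    show "(case (restrict (\<phi> \<circ> ?l) (fst G), restrict (\<phi> \<circ> ?r) (fst H)) of
        (\<alpha>, \<beta>) \<Rightarrow> restrict (case_sum \<alpha> \<beta> \<circ> sum_decode) (?A \<union> ?B)) = \<phi>"
      using PiE_arb[OF \<phi>] by (auto simp: fun_eq_iff)
    show "(restrict (\<phi> \<circ> ?l) (fst G), restrict (\<phi> \<circ> ?r) (fst H)) \<in> (fst G \<rightarrow>\<^sub>E {1..q}) \<times> (fst H \<rightarrow>\<^sub>E {1..q})"
      using PiE_mem[OF \<phi>] by (auto simp del: atLeastAtMost_iff)
    show "(case (restrict (\<phi> \<circ> ?l) (fst G), restrict (\<phi> \<circ> ?r) (fst H)) of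
        (\<alpha>, \<beta>) \<Rightarrow> ?t \<alpha> G * ?t \<beta> H) = ?t \<phi> (raw_disjoint_union G H)"
      by (simp only: prod.case t[OF G] t[OF H])
        (simp add: raw_disjoint_union_def multiset.map_comp map_uprod_comp comp_def)
  next
    fix \<alpha>\<beta> assume "\<alpha>\<beta> \<in> (fst G \<rightarrow>\<^sub>E {1..q}) \<times> (fst H \<rightarrow>\<^sub>E {1..q})"
    then obtain \<alpha> \<beta> where ab: "\<alpha>\<beta> = (\<alpha>, \<beta>)" "\<alpha> \<in> fst G \<rightarrow>\<^sub>E {1..q}" "\<beta> \<in> fst H \<rightarrow>\<^sub>E {1..q}" by blast
    let ?c = "restrict (case_sum \<alpha> \<beta> \<circ> sum_decode) (?A \<union> ?B)"
    have "restrict (?c \<circ> ?l) (fst G) = \<alpha>" "restrict (?c \<circ> ?r) (fst H) = \<beta>"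
      using PiE_arb[OF ab(2)] PiE_arb[OF ab(3)] by (auto simp: fun_eq_iff)
    thus "(restrict ((case \<alpha>\<beta> of (\<alpha>, \<beta>) \<Rightarrow> restrict (case_sum \<alpha> \<beta> \<circ> sum_decode) (?A \<union> ?B)) \<circ> ?l) (fst G),
        restrict ((case \<alpha>\<beta> of (\<alpha>, \<beta>) \<Rightarrow> restrict (case_sum \<alpha> \<beta> \<circ> sum_decode) (?A \<union> ?B)) \<circ> ?r) (fst H)) = \<alpha>\<beta>"
      unfolding ab(1) prod.case by simp
    show "(case \<alpha>\<beta> of (\<alpha>, \<beta>) \<Rightarrow> restrict (case_sum \<alpha> \<beta> \<circ> sum_decode) (?A \<union> ?B)) \<in> ?A \<union> ?B \<rightarrow>\<^sub>E {1..q}"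
      using PiE_mem[OF ab(2)] PiE_mem[OF ab(3)] by (auto simp: ab(1) simp del: atLeastAtMost_iff)
  qed
  also have "\<dots> = (\<Sum>\<alpha>\<in>fst G \<rightarrow>\<^sub>E {1..q}. ?t \<alpha> G) * (\<Sum>\<beta>\<in>fst H \<rightarrow>\<^sub>E {1..q}. ?t \<beta> H)"
    by (simp add: sum_product sum.cartesian_product)
  finally have sum: "(\<Sum>\<phi>\<in>?A \<union> ?B \<rightarrow>\<^sub>E {1..q}. ?t \<phi> (raw_disjoint_union G H)) =
    (\<Sum>\<alpha>\<in>fst G \<rightarrow>\<^sub>E {1..q}. ?t \<alpha> G) * (\<Sum>\<beta>\<in>fst H \<rightarrow>\<^sub>E {1..q}. ?t \<beta> H)" .
  have fst: "fst (raw_disjoint_union G H) = ?A \<union> ?B" by (simp add: raw_disjoint_union_def)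
  have "Const (1 / of_nat q ^ card (?A \<union> ?B)) =
      Const (1 / of_nat q ^ card (fst G)) * Const (1 / of_nat q ^ card (fst H))"
    unfolding card by (simp add: power_add flip: Const_hom.hom_mult)
  thus ?thesis unfolding raw_theta_def fst sum by (simp add: mult_ac)
qed

lemma graph_theta_add: "graph_theta q (F + G) = graph_theta q F * graph_theta q G"
  by transfer (simp add: raw_theta_disjoint_union multigraph_iso_def)

lemma graph_theta_0: "graph_theta q 0 = 1"
  by transfer (simp add: raw_theta_def PiE_empty_domain Const_hom.hom_one)

text \<open>Bilinearity reduces multiplicativity to single basis elements, where the convolution
  product adds the exponents. The coefficient map \<open>c\<close> is left general so that
  \<open>Const\<close> yields the case of \<open>theta\<close> and the identity yields that of the
  density.\<close>

lemma linear_extension_mult: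
  fixes g h :: "'a::comm_monoid_add \<Rightarrow>\<^sub>0 'b::comm_ring_1"
    and c :: "'b \<Rightarrow> 'c::comm_ring_1" and \<phi> :: "'a \<Rightarrow> 'c"
  assumes c: "c 0 = 0" "\<And>a b. c (a + b) = c a + c b" "\<And>a b. c (a * b) = c a * c b"
    and \<phi>: "\<And>F G. \<phi> (F + G) = \<phi> F * \<phi> G"
  defines "ext \<equiv> \<lambda>g. \<Sum>F\<in>Poly_Mapping.keys g. c (Poly_Mapping.lookup g F) * \<phi> F"
  shows "ext (g * h) = ext g * ext h"
proof -
  have add: "ext (p + r) = ext p + ext r" for p r
    unfolding ext_def by (rule setsum_keys_plus_distrib) (simp_all add: c algebra_simps)
  have sum: "ext (sum s A) = (\<Sum>a\<in>A. ext (s a))" for s :: "'a \<Rightarrow> _" and A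
    by (induction A rule: infinite_finite_induct) (simp_all add: add, simp_all add: ext_def)
  have single: "ext (Poly_Mapping.single F a) = c a * \<phi> F" for F a
    by (simp add: ext_def c)
  let ?s = "\<lambda>p m. Poly_Mapping.single m (Poly_Mapping.lookup p m)"
  have "g * h = (\<Sum>m\<in>Poly_Mapping.keys g. \<Sum>n\<in>Poly_Mapping.keys h. ?s g m * ?s h n)"
    using sum_product[of "?s g" "Poly_Mapping.keys g" "?s h" "Poly_Mapping.keys h"]
    by (simp add: eval_hom.sum_singles)
  hence "ext (g * h) = (\<Sum>m\<in>Poly_Mapping.keys g. \<Sum>n\<in>Poly_Mapping.keys h.
      (c (Poly_Mapping.lookup g m) * \<phi> m) * (c (Poly_Mapping.lookup h n) * \<phi> n))"
    by (simp add: sum mult_single single c \<phi> mult_ac)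
  thus ?thesis by (simp add: ext_def sum_product)
qed

lemma theta_power: "theta q (g ^ n) = theta q g ^ n"
proof (induction n)
  case 0
  show ?case by (simp add: theta_def graph_theta_0 Const_hom.hom_one)
next
  case (Suc n)
  have "theta q (g * h) = theta q g * theta q h" for h
    unfolding theta_def
    by (rule linear_extension_mult[where c = Const and \<phi> = "graph_theta q"])
      (simp_all add: Const_hom.hom_zero Const_hom.hom_add Const_hom.hom_mult graph_theta_add)
  thus ?case by (simp add: Suc)
qed

lemma quantum_density_power:
  assumes W: "W \<in> kernels"
  shows "quantum_density (g ^ n) W = quantum_density g W ^ n"
proof (induction n)
  case 0
  show ?case by (simp add: quantum_density_def hom_density_0)
next
  case (Suc n)
  have "quantum_density (g * h) W = quantum_density g W * quantum_density h W" for h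
    unfolding quantum_density_def
    by (rule linear_extension_mult[where c = "\<lambda>c. c" and \<phi> = "\<lambda>F. of_real (hom_density F W)"])
      (simp_all add: hom_density_add[OF W])
  thus ?case by (simp add: Suc)
qed

section \<open>Polynomials\<close>

lemma monomial_product:
  "Poly_Mapping.single m 1 = (\<Prod>v\<in>Poly_Mapping.keys m. Var v ^ Poly_Mapping.lookup m v)"
proof -
  have power: "Var v ^ n = Poly_Mapping.single (Poly_Mapping.single v n) 1" for v n
    by (induction n) (simp_all add: Var_def mult_single flip: single_add)
  have "(\<Prod>v\<in>A. Poly_Mapping.single (k v) 1) = (Poly_Mapping.single (\<Sum>v\<in>A. k v) 1 :: sym_poly)"
    if "finite A" for A :: "nat uprod set" and k
    using that by (induction A) (simp_all add: mult_single)
  thus ?thesis by (simp add: power eval_hom.sum_singles)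
qed

lemma poly_subst_Const_Var: "poly_subst Const Var p = p"
proof -
  have "poly_subst Const Var p =
      (\<Sum>m\<in>Poly_Mapping.keys p. Poly_Mapping.single m (Poly_Mapping.lookup p m))"
    unfolding poly_subst_def monomial_product[symmetric] by (simp add: Const_def mult_single)
  thus ?thesis by (simp add: eval_hom.sum_singles)
qed

text \<open>Every polynomial is the result of substituting its own variables into it, hence a finite
  sum of products of constants and variables. The set of polynomials satisfying \<open>P\<close>
  contains these and is closed under both operations.\<close>

lemma polynomials_induct [consumes 1, case_names Const Var add mult]:
  assumes p: "p \<in> polynomials q"
    and Const: "\<And>a. P (Const a)"
    and Var: "\<And>v. v \<in> sym_indices q \<Longrightarrow> P (Var v)"
    and add: "\<And>p r. p \<in> polynomials q \<Longrightarrow> r \<in> polynomials q \<Longrightarrow> P p \<Longrightarrow> P r \<Longrightarrow> P (p + r)"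
    and mult: "\<And>p r. p \<in> polynomials q \<Longrightarrow> r \<in> polynomials q \<Longrightarrow> P p \<Longrightarrow> P r \<Longrightarrow> P (p * r)"
  shows "P p"
proof -
  define T where "T = {p \<in> polynomials q. P p}"
  have C: "Const a \<in> T" for a by (simp add: T_def Const polynomials_closed)
  have V: "v \<in> sym_indices q \<Longrightarrow> Var v \<in> T" for v by (simp add: T_def Var polynomials_closed)
  have A: "r \<in> T \<Longrightarrow> s \<in> T \<Longrightarrow> r + s \<in> T" and M: "r \<in> T \<Longrightarrow> s \<in> T \<Longrightarrow> r * s \<in> T" for r s
    by (simp_all add: T_def add mult polynomials_closed)
  have one: "1 \<in> T" and zero: "0 \<in> T"
    using C[of 1] C[of 0] by (simp_all add: Const_hom.hom_one Const_hom.hom_zero)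
  have pow: "r \<in> T \<Longrightarrow> r ^ n \<in> T" for r n by (induction n) (simp_all add: one M)
  have prod: "(\<And>v. v \<in> B \<Longrightarrow> h v \<in> T) \<Longrightarrow> prod h B \<in> T" for B :: "nat uprod set" and h
    by (induction B rule: infinite_finite_induct) (simp_all add: one M)
  have sum: "(\<And>m. m \<in> B \<Longrightarrow> h m \<in> T) \<Longrightarrow> sum h B \<in> T" for B :: "(nat uprod \<Rightarrow>\<^sub>0 nat) set" and h
    by (induction B rule: infinite_finite_induct) (simp_all add: zero A)
  have "poly_subst Const Var p \<in> T"
    unfolding poly_subst_def using p
    by (intro sum M C prod pow V) (auto simp: polynomials_def)
  thus ?thesis by (simp add: poly_subst_Const_Var T_def)
qed

text \<open>The outer substitution is a ring homomorphism and passes through the sums, products and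
  powers of the inner one. With \<open>c = Const\<close> it shows that successive permutations of
  the variables compose.\<close>

lemma (in coefficient_hom) poly_subst_compose:
  "poly_subst c f (poly_subst Const h p) = poly_subst c (\<lambda>v. poly_subst c f (h v)) p"
proof -
  have prod: "poly_subst c f (prod k B) = (\<Prod>b\<in>B. poly_subst c f (k b))" for k and B :: "nat uprod set"
    by (induction B rule: infinite_finite_induct) (simp_all add: poly_subst_mult)
  have power: "poly_subst c f (r ^ n) = poly_subst c f r ^ n" for r n
    by (induction n) (simp_all add: poly_subst_mult)
  show ?thesis
    unfolding poly_subst_def[of Const h] poly_subst_def[of c "\<lambda>v. poly_subst c f (h v)"]
    by (simp add: poly_subst_sum poly_subst_mult poly_subst_Const prod power)
qed

lemma Const_minus: "Const (- a) = - Const a"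
  using Const_hom.hom_add[of a "- a"] by (simp add: Const_hom.hom_zero eq_neg_iff_add_eq_0 add.commute)

lemma polynomials_minus:
  assumes "p \<in> polynomials q" "r \<in> polynomials q"
  shows "p - r \<in> polynomials q"
proof -
  have "p + Const (- 1) * r \<in> polynomials q"
    using assms by (intro polynomials_closed)
  thus ?thesis by (simp add: Const_minus Const_hom.hom_one)
qed

lemma polynomials_power: "p \<in> polynomials q \<Longrightarrow> p ^ n \<in> polynomials q"
  by (induction n) (simp_all add: polynomials_closed)

lemma polynomials_sum: "(\<And>a. a \<in> A \<Longrightarrow> h a \<in> polynomials q) \<Longrightarrow> sum h A \<in> polynomials q"
  by (induction A rule: infinite_finite_induct) (simp_all add: polynomials_closed)

lemma polynomials_prod: "(\<And>a. a \<in> A \<Longrightarrow> h a \<in> polynomials q) \<Longrightarrow> prod h A \<in> polynomials q"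
  by (induction A rule: infinite_finite_induct) (simp_all add: polynomials_closed)

lemma finite_sym_indices: "finite (sym_indices q)"
proof -
  have "sym_indices q \<subseteq> (\<lambda>(i, j). Upair i j) ` ({1..q} \<times> {1..q})"
    by (auto simp: sym_indices_def)
  thus ?thesis by (rule finite_subset) simp
qed

text \<open>The filtration by the largest exponent has finite-dimensional pieces.\<close>

definition bounded_monomials :: "nat \<Rightarrow> nat \<Rightarrow> (nat uprod \<Rightarrow>\<^sub>0 nat) set" where
  "bounded_monomials q d =
     {m. Poly_Mapping.keys m \<subseteq> sym_indices q \<and> (\<forall>v. Poly_Mapping.lookup m v \<le> d)}"

lemma finite_bounded_monomials: "finite (bounded_monomials q d)"
proof (rule finite_imageD)
  have "Poly_Mapping.lookup ` bounded_monomials q d \<subseteq>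
      {k. \<forall>v. (v \<in> sym_indices q \<longrightarrow> k v \<in> {..d}) \<and> (v \<notin> sym_indices q \<longrightarrow> k v = 0)}"
    by (auto simp: bounded_monomials_def in_keys_iff)
  thus "finite (Poly_Mapping.lookup ` bounded_monomials q d)"
    by (rule finite_subset) (intro finite_set_of_finite_funs finite_sym_indices finite_atMost)
  show "inj_on Poly_Mapping.lookup (bounded_monomials q d)"
    by (auto intro: inj_onI simp: lookup_inject)
qed

lemma polynomial_bounded_monomials:
  assumes "p \<in> polynomials q"
  shows "\<exists>d. Poly_Mapping.keys p \<subseteq> bounded_monomials q d"
proof -
  define E where "E = (\<Union>m\<in>Poly_Mapping.keys p. Poly_Mapping.lookup m ` sym_indices q)"
  have "finite E" by (simp add: E_def finite_sym_indices)
  \<comment> \<open>The inserted 0 keeps the maximum well defined when \<open>E\<close> is empty,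
    for instance when \<open>p = 0\<close>.\<close>
  have "Poly_Mapping.lookup m v \<le> Max (insert 0 E)" if m: "m \<in> Poly_Mapping.keys p" for m v
  proof (cases "v \<in> sym_indices q")
    case True
    thus ?thesis using m \<open>finite E\<close> by (intro Max_ge) (auto simp: E_def)
  next
    case False
    hence "v \<notin> Poly_Mapping.keys m" using assms m by (auto simp: polynomials_def)
    thus ?thesis by (simp add: in_keys_iff)
  qed
  hence "Poly_Mapping.keys p \<subseteq> bounded_monomials q (Max (insert 0 E))"
    using assms by (auto simp: bounded_monomials_def polynomials_def)
  thus ?thesis ..
qed

section \<open>Ideals of the polynomial ring\<close>

text \<open>Ideals of the full polynomial ring are plain sets, so that computations use the
  arithmetic of the type itself. Closure under negation comes from multiplication by
  \<open>Const (- 1)\<close>.\<close>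

definition poly_ideal :: "nat \<Rightarrow> sym_poly set \<Rightarrow> bool" where
  "poly_ideal q I \<longleftrightarrow> I \<subseteq> polynomials q \<and> 0 \<in> I \<and> (\<forall>x\<in>I. \<forall>y\<in>I. x + y \<in> I) \<and>
     (\<forall>r\<in>polynomials q. \<forall>x\<in>I. r * x \<in> I)"

lemma poly_idealD:
  assumes "poly_ideal q I"
  shows "x \<in> I \<Longrightarrow> x \<in> polynomials q" "0 \<in> I" "x \<in> I \<Longrightarrow> y \<in> I \<Longrightarrow> x + y \<in> I"
    "r \<in> polynomials q \<Longrightarrow> x \<in> I \<Longrightarrow> r * x \<in> I" "r \<in> polynomials q \<Longrightarrow> x \<in> I \<Longrightarrow> x * r \<in> I"
  using assms unfolding poly_ideal_def by (auto simp: mult.commute)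

lemma poly_ideal_minus:
  assumes I: "poly_ideal q I" and "x \<in> I" "y \<in> I"
  shows "x - y \<in> I"
proof -
  have "x + Const (- 1) * y \<in> I"
    using assms by (intro poly_idealD(3,4)[OF I] polynomials_closed)
  thus ?thesis by (simp add: Const_minus Const_hom.hom_one)
qed

lemma poly_ideal_sum:
  assumes "poly_ideal q I" "\<And>a. a \<in> A \<Longrightarrow> h a \<in> I"
  shows "sum h A \<in> I"
  using assms(2) by (induction A rule: infinite_finite_induct) (simp_all add: poly_idealD[OF assms(1)])

text \<open>For \<open>f\<close> in \<open>polynomials q\<close> these ideals correspond to the
  maximal ideals of the localisation at \<open>f\<close>. The exponent 0 is included, so 1 lies
  outside \<open>P\<close>.\<close>

definition maximal_avoiding :: "nat \<Rightarrow> sym_poly \<Rightarrow> sym_poly set \<Rightarrow> bool" where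
  "maximal_avoiding q f P \<longleftrightarrow> poly_ideal q P \<and> (\<forall>n. f ^ n \<notin> P) \<and>
     (\<forall>I. poly_ideal q I \<and> P \<subseteq> I \<and> (\<forall>n. f ^ n \<notin> I) \<longrightarrow> I = P)"

lemma maximal_avoidingD:
  assumes "maximal_avoiding q f P"
  shows "poly_ideal q P" "f ^ n \<notin> P"
    and "poly_ideal q I \<Longrightarrow> P \<subseteq> I \<Longrightarrow> (\<And>n. f ^ n \<notin> I) \<Longrightarrow> I = P"
  using assms unfolding maximal_avoiding_def by auto

text \<open>Zorn's lemma applies: the union of a nonempty chain of ideals is an ideal, and a power
  of \<open>f\<close> in the union would already lie in a member of the chain.\<close>

lemma exists_maximal_avoiding:
  assumes J: "poly_ideal q J" and f: "\<And>n. f ^ n \<notin> J"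
  shows "\<exists>P. maximal_avoiding q f P \<and> J \<subseteq> P"
proof -
  define \<A> where "\<A> = {I. poly_ideal q I \<and> J \<subseteq> I \<and> (\<forall>n. f ^ n \<notin> I)}"
  have "\<exists>M\<in>\<A>. \<forall>X\<in>\<A>. M \<subseteq> X \<longrightarrow> X = M"
  proof (rule subset_Zorn_nonempty)
    show "\<A> \<noteq> {}" using J f by (auto simp: \<A>_def)
  next
    fix C assume C: "C \<noteq> {}" "subset.chain \<A> C"
    have sub: "poly_ideal q I" "J \<subseteq> I" "f ^ n \<notin> I" if "I \<in> C" for I n
      using C that by (auto simp: subset.chain_def \<A>_def)
    have "x + y \<in> \<Union>C" if xy: "x \<in> \<Union>C" "y \<in> \<Union>C" for x y
    proof -
      obtain I I' where I: "x \<in> I" "I \<in> C" "y \<in> I'" "I' \<in> C" using xy by blast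
      hence "I \<subseteq> I' \<or> I' \<subseteq> I" using C unfolding subset_chain_def by blast
      thus ?thesis using I poly_idealD(3)[OF sub(1)] by blast
    qed
    hence "poly_ideal q (\<Union>C)"
      unfolding poly_ideal_def[of q "\<Union>C"]
    proof (intro conjI ballI subsetI)
      show "0 \<in> \<Union>C" using C(1) poly_idealD(2)[OF sub(1)] by blast
      show "x \<in> polynomials q" if "x \<in> \<Union>C" for x
        using that poly_idealD(1)[OF sub(1)] by blast
      show "r * x \<in> \<Union>C" if "r \<in> polynomials q" "x \<in> \<Union>C" for r x
        using that poly_idealD(4)[OF sub(1)] by blast
    qed
    thus "\<Union>C \<in> \<A>" using C(1) sub unfolding \<A>_def by blast
  qed
  then obtain M where "M \<in> \<A>" "\<And>X. X \<in> \<A> \<Longrightarrow> M \<subseteq> X \<Longrightarrow> X = M" by blast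
  hence "maximal_avoiding q f M \<and> J \<subseteq> M"
    unfolding \<A>_def maximal_avoiding_def by blast
  thus ?thesis ..
qed

text \<open>Otherwise the ideal generated by \<open>P\<close> and \<open>h\<close> would still avoid
  all powers of \<open>f\<close>, and maximality would force it to equal \<open>P\<close>, although
  it contains \<open>h\<close>. Thus \<open>h\<close> becomes invertible modulo \<open>P\<close>
  once \<open>f\<close> is inverted.\<close>

lemma maximal_avoiding_inverse_mod:
  assumes max: "maximal_avoiding q f P"
    and h: "h \<in> polynomials q" "h \<notin> P"
  shows "\<exists>n a. a \<in> polynomials q \<and> f ^ n - a * h \<in> P"
proof (rule ccontr)
  note P = maximal_avoidingD(1)[OF max]
  assume none: "\<not> ?thesis"
  define I where "I = {p + a * h |p a. p \<in> P \<and> a \<in> polynomials q}"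
  have "poly_ideal q I"
    unfolding poly_ideal_def
  proof (intro conjI ballI subsetI)
    fix x assume "x \<in> I"
    then obtain p a where x: "x = p + a * h" "p \<in> P" "a \<in> polynomials q" by (auto simp: I_def)
    show "x \<in> polynomials q"
      unfolding x(1) using x(3) h poly_idealD(1)[OF P x(2)] by (simp add: polynomials_closed)
    { fix y assume "y \<in> I"
      then obtain p' a' where y: "y = p' + a' * h" "p' \<in> P" "a' \<in> polynomials q" by (auto simp: I_def)
      have "x + y = (p + p') + (a + a') * h" by (simp add: x y algebra_simps)
      thus "x + y \<in> I"
        unfolding I_def using x(2,3) y(2,3) poly_idealD(3)[OF P] polynomials_closed(4) by blast }
    { fix r assume r: "r \<in> polynomials q"
      have "r * x = r * p + (r * a) * h" by (simp add: x algebra_simps)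
      thus "r * x \<in> I"
        unfolding I_def using x(2,3) r poly_idealD(4)[OF P] polynomials_closed(5) by blast }
  next
    have "0 = 0 + 0 * h" by simp
    thus "0 \<in> I" unfolding I_def using poly_idealD(2)[OF P] polynomials_closed(1) by blast
  qed
  moreover have "P \<subseteq> I"
  proof
    fix p assume "p \<in> P"
    moreover have "p = p + 0 * h" by simp
    ultimately show "p \<in> I" unfolding I_def using polynomials_closed(1) by blast
  qed
  moreover have "f ^ n \<notin> I" for n
  proof
    assume "f ^ n \<in> I"
    then obtain p a where "f ^ n = p + a * h" "p \<in> P" "a \<in> polynomials q" by (auto simp: I_def)
    hence "f ^ n - a * h \<in> P" by simp
    with none \<open>a \<in> polynomials q\<close> show False by blast
  qed
  ultimately have "I = P" by (rule maximal_avoidingD(3)[OF max])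
  moreover have "h \<in> I"
  proof -
    have "h = 0 + 1 * h" by simp
    thus ?thesis unfolding I_def using poly_idealD(2)[OF P] polynomials_closed(2) by blast
  qed
  ultimately show False using h by simp
qed

text \<open>If neither factor were in \<open>P\<close>, some powers of \<open>f\<close> would be
  congruent to \<open>a * h\<close> and to \<open>b * k\<close>. Their product would be a power of
  \<open>f\<close> congruent to a multiple of \<open>h * k\<close>, hence an element of
  \<open>P\<close>.\<close>

lemma maximal_avoiding_prime:
  assumes max: "maximal_avoiding q f P" and f: "f \<in> polynomials q"
    and h: "h \<in> polynomials q" "k \<in> polynomials q" "h * k \<in> P"
  shows "h \<in> P \<or> k \<in> P"
proof (rule ccontr)
  note P = maximal_avoidingD(1)[OF max]
  assume "\<not> (h \<in> P \<or> k \<in> P)"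
  then obtain n a m b where a: "a \<in> polynomials q" "f ^ n - a * h \<in> P"
    and b: "b \<in> polynomials q" "f ^ m - b * k \<in> P"
    using maximal_avoiding_inverse_mod[OF max] h by metis
  have "(f ^ n - a * h) * f ^ m + (a * h) * (f ^ m - b * k) + (a * b) * (h * k) \<in> P"
    using a b h f by (simp add: poly_idealD[OF P] polynomials_closed polynomials_power)
  moreover have "(f ^ n - a * h) * f ^ m + (a * h) * (f ^ m - b * k) + (a * b) * (h * k) = f ^ (n + m)"
    by (simp add: algebra_simps power_add)
  ultimately show False using maximal_avoidingD(2)[OF max] by metis
qed

section \<open>Hilbert's Nullstellensatz over an uncountable field\<close>

text \<open>Infinitely many vectors in the finite-dimensional space of functions on \<open>K\<close>
  are linearly dependent. Adding a coordinate \<open>k\<close> to \<open>K\<close> uses two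
  relations with disjoint supports, which an infinite family always supplies; a combination of them
  cancels at \<open>k\<close>.\<close>

lemma infinite_family_dependent:
  fixes a :: "'i \<Rightarrow> 'k \<Rightarrow> 'c::field"
  assumes "finite K" "infinite \<Lambda>"
  shows "\<exists>L c. finite L \<and> L \<subseteq> \<Lambda> \<and> L \<noteq> {} \<and> (\<forall>l\<in>L. c l \<noteq> 0) \<and> (\<forall>k\<in>K. (\<Sum>l\<in>L. c l * a l k) = 0)"
  using assms
proof (induction K arbitrary: \<Lambda> rule: finite_induct)
  case empty
  then obtain l where "l \<in> \<Lambda>" using infinite_imp_nonempty by blast
  thus ?case by (intro exI[of _ "{l}"] exI[of _ "\<lambda>_. 1"]) auto
next
  case (insert k K)
  obtain L c where 1: "finite L" "L \<subseteq> \<Lambda>" "L \<noteq> {}" "\<And>l. l \<in> L \<Longrightarrow> c l \<noteq> 0"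
      "\<And>k. k \<in> K \<Longrightarrow> (\<Sum>l\<in>L. c l * a l k) = 0"
    using insert.IH[OF insert.prems] by metis
  have "infinite (\<Lambda> - L)" using insert.prems 1(1) by simp
  then obtain L' c' where 2: "finite L'" "L' \<subseteq> \<Lambda> - L" "L' \<noteq> {}" "\<And>l. l \<in> L' \<Longrightarrow> c' l \<noteq> 0"
      "\<And>k. k \<in> K \<Longrightarrow> (\<Sum>l\<in>L'. c' l * a l k) = 0"
    using insert.IH by metis
  define s s' where "s = (\<Sum>l\<in>L. c l * a l k)" and "s' = (\<Sum>l\<in>L'. c' l * a l k)"
  show ?case
  proof (cases "s = 0 \<or> s' = 0")
    case True
    thus ?thesis
    proof
      assume "s = 0" thus ?thesis using 1 by (intro exI[of _ L] exI[of _ c]) (auto simp: s_def)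
    next
      assume "s' = 0" thus ?thesis using 2 by (intro exI[of _ L'] exI[of _ c']) (auto simp: s'_def)
    qed
  next
    case False
    \<comment> \<open>The weights \<open>s'\<close> and \<open>- s\<close> give
      \<open>s' * s - s * s' = 0\<close> at \<open>k\<close>. As both are nonzero and the supports
      are disjoint, no coefficient vanishes.\<close>
    define d where "d l = (if l \<in> L then s' * c l else - s * c' l)" for l
    have "(\<Sum>l\<in>L \<union> L'. d l * a l j) = s' * (\<Sum>l\<in>L. c l * a l j) - s * (\<Sum>l\<in>L'. c' l * a l j)" for j
    proof -
      have "(\<Sum>l\<in>L \<union> L'. d l * a l j) = (\<Sum>l\<in>L. d l * a l j) + (\<Sum>l\<in>L'. d l * a l j)"
        using 1 2 by (intro sum.union_disjoint) auto
      also have "(\<Sum>l\<in>L. d l * a l j) = s' * (\<Sum>l\<in>L. c l * a l j)"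
        by (simp add: d_def sum_distrib_left mult.assoc)
      also have "(\<Sum>l\<in>L'. d l * a l j) = (\<Sum>l\<in>L'. - s * (c' l * a l j))"
        using 2(2) by (intro sum.cong) (auto simp: d_def)
      finally show ?thesis by (simp add: sum_distrib_left sum_negf)
    qed
    hence "(\<Sum>l\<in>L \<union> L'. d l * a l j) = 0" if "j \<in> insert k K" for j
      using that 1(5) 2(5) by (auto simp: s_def s'_def)
    moreover have "d l \<noteq> 0" if "l \<in> L \<union> L'" for l
      using that 1(4) 2(4) False by (auto simp: d_def)
    ultimately show ?thesis
      using 1(1-3) 2(1-3) by (intro exI[of _ "L \<union> L'"] exI[of _ d]) auto
  qed
qed

section \<open>Complex univariate polynomials evaluated at a multivariate polynomial\<close>

definition univariate_eval :: "sym_poly \<Rightarrow> complex poly \<Rightarrow> sym_poly" where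
  "univariate_eval y p = poly (map_poly Const p) y"

lemma univariate_eval_pCons: "univariate_eval y (pCons a p) = Const a + y * univariate_eval y p"
  by (simp add: univariate_eval_def map_poly_pCons Const_hom.hom_zero)

lemma univariate_eval_0 [simp]: "univariate_eval y 0 = 0"
  by (simp add: univariate_eval_def)

lemma univariate_eval_add: "univariate_eval y (p + r) = univariate_eval y p + univariate_eval y r"
  by (induction p r rule: poly_induct2)
    (simp_all add: univariate_eval_pCons Const_hom.hom_add algebra_simps)

lemma univariate_eval_smult: "univariate_eval y (smult a p) = Const a * univariate_eval y p"
  by (induction p) (simp_all add: univariate_eval_pCons Const_hom.hom_mult algebra_simps)

lemma univariate_eval_mult: "univariate_eval y (p * r) = univariate_eval y p * univariate_eval y r"
  by (induction p)
    (simp_all add: univariate_eval_pCons univariate_eval_add univariate_eval_smult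
      Const_hom.hom_zero algebra_simps)

lemma univariate_eval_sum: "univariate_eval y (sum h A) = (\<Sum>a\<in>A. univariate_eval y (h a))"
  by (induction A rule: infinite_finite_induct) (simp_all add: univariate_eval_add)

lemma univariate_eval_1 [simp]: "univariate_eval y 1 = 1"
  by (simp add: one_pCons univariate_eval_pCons Const_hom.hom_one)

lemma univariate_eval_prod: "univariate_eval y (prod h A) = (\<Prod>a\<in>A. univariate_eval y (h a))"
  by (induction A rule: infinite_finite_induct) (simp_all add: univariate_eval_mult)

lemma univariate_eval_linear: "univariate_eval y [:- a, 1:] = y - Const a"
  by (simp add: univariate_eval_pCons Const_hom.hom_one Const_minus)

lemma univariate_eval_polynomials:
  "y \<in> polynomials q \<Longrightarrow> univariate_eval y p \<in> polynomials q"
  by (induction p) (simp_all add: univariate_eval_pCons polynomials_closed)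

text \<open>Over the complex numbers \<open>p\<close> splits into linear factors. Each
  \<open>y - Const z\<close> lies outside the prime \<open>P\<close>, and so does the leading
  constant, which is a unit.\<close>

lemma univariate_eval_notin_prime_ideal:
  assumes P: "poly_ideal q P" "1 \<notin> P"
    and prime: "\<And>h k. h \<in> polynomials q \<Longrightarrow> k \<in> polynomials q \<Longrightarrow> h * k \<in> P \<Longrightarrow> h \<in> P \<or> k \<in> P"
    and y: "y \<in> polynomials q" "\<And>a. y - Const a \<notin> P"
  shows "p \<noteq> 0 \<Longrightarrow> univariate_eval y p \<notin> P"
proof (induction "degree p" arbitrary: p)
  case 0
  then obtain a where a: "p = [:a:]" "a \<noteq> 0" by (metis degree_eq_zeroE pCons_0_0)
  show ?case
  proof
    assume "univariate_eval y p \<in> P"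
    hence "Const (1 / a) * Const a \<in> P"
      using a by (intro poly_idealD(4)[OF P(1)] polynomials_closed) (simp add: univariate_eval_pCons)
    thus False using P(2) a(2) by (simp add: Const_hom.hom_one flip: Const_hom.hom_mult)
  qed
next
  case (Suc n)
  have "\<not> constant (poly p)" using Suc.hyps(2) by (simp add: constant_degree)
  then obtain z where "poly p z = 0" using fundamental_theorem_of_algebra by blast
  then obtain r where r: "p = [:- z, 1:] * r" by (metis poly_eq_0_iff_dvd dvdE)
  have "r \<noteq> 0" using Suc.prems r by auto
  moreover have "n = degree r"
    using Suc.hyps(2) \<open>r \<noteq> 0\<close> unfolding r by (subst (asm) degree_mult_eq) auto
  ultimately have "univariate_eval y r \<notin> P" using Suc.hyps(1) by blast
  hence "(y - Const z) * univariate_eval y r \<notin> P"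
    using prime[of "y - Const z" "univariate_eval y r"] y
    by (auto simp: polynomials_closed polynomials_minus univariate_eval_polynomials)
  thus ?case unfolding r univariate_eval_mult univariate_eval_linear .
qed

text \<open>If no \<open>y - a\<close> lay in the ideal, then \<open>f ^ n / (y - a)\<close>, for uncountably many \<open>a\<close> and a common
  exponent, would be represented in one of countably many finite-dimensional spaces, and clearing
  denominators in a linear relation between them would make \<open>y\<close> algebraic.\<close>

lemma maximal_avoiding_contains_shift:
  assumes max: "maximal_avoiding q f P" and f: "f \<in> polynomials q"
    and y: "y \<in> polynomials q"
  shows "\<exists>a. y - Const a \<in> P"
proof (rule ccontr)
  note P = maximal_avoidingD(1)[OF max]
  note prime = maximal_avoiding_prime[OF max f]
  assume "\<not> ?thesis"
  hence notin: "\<And>a. y - Const a \<notin> P" by blast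
  have lin: "y - Const l \<in> polynomials q" for l using y by (intro polynomials_minus polynomials_closed)
  have "\<forall>l. \<exists>n b d. b \<in> polynomials q \<and> f ^ n - b * (y - Const l) \<in> P \<and>
      Poly_Mapping.keys b \<subseteq> bounded_monomials q d"
  proof
    fix l
    obtain n b where b: "b \<in> polynomials q" "f ^ n - b * (y - Const l) \<in> P"
      using maximal_avoiding_inverse_mod[OF max lin[of l] notin[of l]] by blast
    obtain d where "Poly_Mapping.keys b \<subseteq> bounded_monomials q d"
      using polynomial_bounded_monomials[OF b(1)] by blast
    with b show "\<exists>n b d. b \<in> polynomials q \<and> f ^ n - b * (y - Const l) \<in> P \<and>
      Poly_Mapping.keys b \<subseteq> bounded_monomials q d" by blast
  qed
  then obtain n b d where b: "\<And>l. b l \<in> polynomials q" "\<And>l. f ^ n l - b l * (y - Const l) \<in> P"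
      "\<And>l. Poly_Mapping.keys (b l) \<subseteq> bounded_monomials q (d l)"
    unfolding choice_iff by blast
  \<comment> \<open>Finite fibres over the countably many pairs \<open>(i, j)\<close> could not
    cover the uncountable field. One infinite fibre suffices for the linear relation that
    follows.\<close>
  have "\<exists>i j. infinite {l. n l = i \<and> d l = j}"
  proof (rule ccontr)
    assume "\<not> ?thesis"
    hence "countable (\<Union>i. \<Union>j. {l. n l = i \<and> d l = j})"
      by (intro countable_UN) (auto intro: countable_finite)
    moreover have "(\<Union>i. \<Union>j. {l. n l = i \<and> d l = j}) = UNIV" by auto
    ultimately show False using uncountable_UNIV_complex by simp
  qed
  then obtain i j where inf: "infinite {l. n l = i \<and> d l = j}" by blast
  obtain L c where L: "finite L" "L \<subseteq> {l. n l = i \<and> d l = j}" "L \<noteq> {}" "\<And>l. l \<in> L \<Longrightarrow> c l \<noteq> 0"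
      "\<And>m. m \<in> bounded_monomials q j \<Longrightarrow> (\<Sum>l\<in>L. c l * Poly_Mapping.lookup (b l) m) = 0"
    using infinite_family_dependent[OF finite_bounded_monomials[of q j] inf,
        of "\<lambda>l. Poly_Mapping.lookup (b l)"] by blast
  have dep: "(\<Sum>l\<in>L. Const (c l) * b l) = 0"
  proof (rule poly_mapping_eqI)
    fix m
    have lookup: "Poly_Mapping.lookup (Const a * p) m = a * Poly_Mapping.lookup p m" for a p
      by (simp add: Const_def Poly_Mapping.map.rep_eq when_def flip: mult_map_scale_conv_mult)
    show "Poly_Mapping.lookup (\<Sum>l\<in>L. Const (c l) * b l) m = Poly_Mapping.lookup 0 m"
    proof (cases "m \<in> bounded_monomials q j")
      case True
      thus ?thesis using L(5) by (simp add: lookup_sum lookup)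
    next
      case False
      hence "Poly_Mapping.lookup (b l) m = 0" if "l \<in> L" for l
        using b(3)[of l] L(2) that by (auto simp: in_keys_iff)
      thus ?thesis by (simp add: lookup_sum lookup)
    qed
  qed
  \<comment> \<open>This is the numerator of the sum of \<open>c l / (T - l)\<close> over the common
    denominator. At a point \<open>l\<^sub>0\<close> of \<open>L\<close> only the summand for
    \<open>l\<^sub>0\<close> survives, and it is nonzero.\<close>
  define G where "G = (\<Sum>l\<in>L. smult (c l) (\<Prod>m\<in>L - {l}. [:- m, 1:]))"
  obtain l\<^sub>0 where l\<^sub>0: "l\<^sub>0 \<in> L" using L(3) by blast
  have "poly G l\<^sub>0 = (\<Sum>l\<in>L. if l = l\<^sub>0 then c l * (\<Prod>m\<in>L - {l}. l\<^sub>0 - m) else 0)"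
    unfolding G_def poly_sum
    using L(1) l\<^sub>0 by (intro sum.cong refl) (auto simp: poly_prod)
  also have "\<dots> \<noteq> 0"
    using L(1,4) l\<^sub>0 by simp
  finally have "G \<noteq> 0" by auto
  define D where "D = (\<lambda>A. \<Prod>m\<in>A. y - Const m)"
  have D: "D A \<in> polynomials q" for A unfolding D_def by (intro polynomials_prod lin)
  have "f ^ i * univariate_eval y G \<in> P"
  proof -
    \<comment> \<open>The factor \<open>y - Const l\<close> completes \<open>D (L - {l})\<close> to
      \<open>D L\<close>. The terms with \<open>b l\<close> then add up to \<open>D L\<close> times
      the relation \<open>dep\<close>, leaving only
      \<open>f ^ i * univariate_eval y G\<close>.\<close>
    have "(\<Sum>l\<in>L. Const (c l) * D (L - {l}) * (f ^ n l - b l * (y - Const l))) \<in> P"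
      using b(2) by (intro poly_ideal_sum[OF P] poly_idealD(4)[OF P] polynomials_closed D)
    also have "(\<Sum>l\<in>L. Const (c l) * D (L - {l}) * (f ^ n l - b l * (y - Const l))) =
        (\<Sum>l\<in>L. f ^ i * (Const (c l) * D (L - {l})) - D L * (Const (c l) * b l))"
    proof (intro sum.cong refl)
      fix l assume l: "l \<in> L"
      have D_L: "D L = (y - Const l) * D (L - {l})"
        unfolding D_def using l L(1) by (simp add: prod.remove)
      have n_l: "n l = i" using l L(2) by blast
      show "Const (c l) * D (L - {l}) * (f ^ n l - b l * (y - Const l)) =
          f ^ i * (Const (c l) * D (L - {l})) - D L * (Const (c l) * b l)"
        unfolding D_L n_l by (simp add: algebra_simps)
    qed
    also have "\<dots> = f ^ i * univariate_eval y G - D L * (\<Sum>l\<in>L. Const (c l) * b l)"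
      by (simp add: sum_subtractf G_def univariate_eval_sum univariate_eval_smult
          univariate_eval_prod univariate_eval_linear D_def flip: sum_distrib_left)
    finally show ?thesis by (simp add: dep)
  qed
  moreover have "1 \<notin> P" using maximal_avoidingD(2)[OF max, of 0] by simp
  hence "univariate_eval y G \<notin> P"
    using univariate_eval_notin_prime_ideal[OF P _ prime y notin \<open>G \<noteq> 0\<close>] by blast
  ultimately show False
    using prime[OF polynomials_power[OF f] univariate_eval_polynomials[OF y]]
      maximal_avoidingD(2)[OF max] by blast
qed

theorem nullstellensatz:
  assumes J: "poly_ideal q J" and f: "f \<in> polynomials q"
    and vanish: "\<And>X. X \<in> zero_locus q J \<Longrightarrow> poly_eval X f = 0"
  shows "\<exists>n. f ^ n \<in> J"
proof (rule ccontr)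
  assume "\<not> ?thesis"
  then obtain P where max: "maximal_avoiding q f P" and JP: "J \<subseteq> P"
    using exists_maximal_avoiding[OF J, of f] by blast
  note P = maximal_avoidingD(1,2)[OF max]
  have "\<exists>a. v \<in> sym_indices q \<longrightarrow> Var v - Const a \<in> P" for v
    using maximal_avoiding_contains_shift[OF max f] polynomials_closed(6) by blast
  then obtain Y where Y: "\<And>v. v \<in> sym_indices q \<Longrightarrow> Var v - Const (Y v) \<in> P" by metis
  \<comment> \<open>Points of \<open>zero_locus\<close> are extensional functions, hence the
    restriction.\<close>
  define X where "X = restrict Y (sym_indices q)"
  \<comment> \<open>Reduction modulo \<open>P\<close> agrees with evaluation at \<open>X\<close> on
    constants and variables, hence on all polynomials.\<close>
  have eval: "p - Const (poly_eval X p) \<in> P" if "p \<in> polynomials q" for p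
    using that
  proof (induction p rule: polynomials_induct)
    case (Const a)
    show ?case by (simp add: poly_eval_def eval_hom.poly_subst_Const poly_idealD(2)[OF P(1)])
  next
    case (Var v)
    thus ?case using Y[OF Var] by (simp add: poly_eval_def eval_hom.poly_subst_Var X_def)
  next
    case (add p r)
    hence "(p - Const (poly_eval X p)) + (r - Const (poly_eval X r)) \<in> P"
      by (intro poly_idealD(3)[OF P(1)])
    thus ?case
      by (simp add: poly_eval_def eval_hom.poly_subst_add Const_hom.hom_add algebra_simps)
  next
    case (mult p r)
    hence "(p - Const (poly_eval X p)) * r + Const (poly_eval X p) * (r - Const (poly_eval X r)) \<in> P"
      by (intro poly_idealD(3-5)[OF P(1)] polynomials_closed)
    thus ?case
      by (simp add: poly_eval_def eval_hom.poly_subst_mult Const_hom.hom_mult algebra_simps)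
  qed
  \<comment> \<open>A nonzero value would be a unit congruent to \<open>h\<close>, which lies in
    \<open>P\<close>; then 1 would lie in \<open>P\<close>.\<close>
  have "poly_eval X h = 0" if "h \<in> J" for h
  proof (rule ccontr)
    assume nz: "poly_eval X h \<noteq> 0"
    have "h \<in> P" using that JP by blast
    hence "h - (h - Const (poly_eval X h)) \<in> P"
      by (intro poly_ideal_minus[OF P(1)] eval poly_idealD(1)[OF P(1)])
    hence "Const (1 / poly_eval X h) * Const (poly_eval X h) \<in> P"
      by (intro poly_idealD(4)[OF P(1)] polynomials_closed) simp
    thus False
      using P(2)[of 0] nz by (simp add: Const_hom.hom_one flip: Const_hom.hom_mult)
  qed
  hence "X \<in> zero_locus q J" by (simp add: zero_locus_def X_def)
  hence "poly_eval X f = 0" by (rule vanish)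
  hence "f \<in> P" using eval[OF f] by (simp add: Const_hom.hom_zero)
  thus False using P(2)[of 1] by simp
qed

section \<open>The Reynolds operator\<close>

definition reynolds :: "nat \<Rightarrow> sym_poly \<Rightarrow> sym_poly" where
  "reynolds q p = Const (1 / fact q) * (\<Sum>\<pi> | \<pi> permutes {1..q}. permute_vars \<pi> p)"

lemma permute_vars_hom:
  "permute_vars \<pi> (p + r) = permute_vars \<pi> p + permute_vars \<pi> r"
  "permute_vars \<pi> (p * r) = permute_vars \<pi> p * permute_vars \<pi> r"
  "permute_vars \<pi> (Const a) = Const a"
  "permute_vars \<pi> (sum h A) = (\<Sum>a\<in>A. permute_vars \<pi> (h a))"
  by (simp_all add: permute_vars_def Const_hom.poly_subst_add Const_hom.poly_subst_mult
      Const_hom.poly_subst_Const Const_hom.poly_subst_sum)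

lemma permute_vars_comp: "permute_vars \<pi> (permute_vars \<sigma> p) = permute_vars (\<pi> \<circ> \<sigma>) p"
  by (simp add: permute_vars_def Const_hom.poly_subst_compose Const_hom.poly_subst_Var map_uprod_comp)

lemma permute_vars_polynomials:
  assumes "\<pi> permutes {1..q}" "p \<in> polynomials q"
  shows "permute_vars \<pi> p \<in> polynomials q"
  using assms(2)
proof (induction p rule: polynomials_induct)
  case (Var v)
  then obtain i j where "v = Upair i j" "i \<in> {1..q}" "j \<in> {1..q}" by (auto simp: sym_indices_def)
  hence "map_uprod \<pi> v \<in> sym_indices q"
    using permutes_in_image[OF assms(1)] unfolding sym_indices_def by auto
  thus ?case by (simp add: permute_vars_def Const_hom.poly_subst_Var polynomials_closed)
qed (simp_all add: permute_vars_hom polynomials_closed)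

text \<open>Left composition with \<open>\<sigma>\<close> only reorders the summands of the
  average.\<close>

lemma reynolds_in_invariants:
  assumes p: "p \<in> polynomials q"
  shows "reynolds q p \<in> invariants q"
proof -
  let ?S = "{\<pi>. \<pi> permutes {1..q}}"
  have "permute_vars \<sigma> (reynolds q p) = reynolds q p" if \<sigma>: "\<sigma> permutes {1..q}" for \<sigma>
  proof -
    have "(\<Sum>\<pi>\<in>?S. permute_vars (\<sigma> \<circ> \<pi>) p) = (\<Sum>\<pi>\<in>?S. permute_vars \<pi> p)"
      by (rule setum_permutations_compose_left[OF \<sigma>, of "\<lambda>\<pi>. permute_vars \<pi> p", symmetric])
    thus ?thesis by (simp add: reynolds_def permute_vars_hom permute_vars_comp)
  qed
  moreover have "reynolds q p \<in> polynomials q"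
    unfolding reynolds_def
    using p by (intro polynomials_closed polynomials_sum permute_vars_polynomials) simp_all
  ultimately show ?thesis by (simp add: invariants_def)
qed

lemma reynolds_add: "reynolds q (p + r) = reynolds q p + reynolds q r"
  by (simp add: reynolds_def permute_vars_hom sum.distrib algebra_simps)

text \<open>Every permutation fixes an invariant factor, so it can be pulled out of the average.
  With \<open>r = 1\<close> this shows that invariants are their own averages.\<close>

lemma reynolds_mult_invariant:
  assumes "h \<in> invariants q"
  shows "reynolds q (r * h) = reynolds q r * h"
proof -
  have "(\<Sum>\<pi> | \<pi> permutes {1..q}. permute_vars \<pi> (r * h)) =
      (\<Sum>\<pi> | \<pi> permutes {1..q}. permute_vars \<pi> r * h)"
    using assms by (intro sum.cong refl) (simp add: permute_vars_hom invariants_def)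
  thus ?thesis by (simp add: reynolds_def sum_distrib_right mult.assoc)
qed

lemma reynolds_one: "reynolds q 1 = 1"
proof -
  have "permute_vars \<pi> 1 = 1" for \<pi> by (simp add: permute_vars_def)
  hence "reynolds q 1 = Const (1 / fact q) * of_nat (fact q)"
    using card_permutations[of "{1..q}" q] by (simp add: reynolds_def)
  also have "of_nat k = Const (of_nat k)" for k
    by (induction k) (simp_all add: Const_hom.hom_zero Const_hom.hom_one Const_hom.hom_add)
  finally show ?thesis by (simp add: Const_hom.hom_one flip: Const_hom.hom_mult)
qed

theorem invariant_nullstellensatz:
  assumes \<aa>: "ideal \<aa> (invariant_ring q)" and f: "f \<in> invariants q"
    and vanish: "\<forall>X\<in>zero_locus q \<aa>. poly_eval X f = 0"
  shows "\<exists>n. f ^ n \<in> \<aa>"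
proof -
  interpret ideal \<aa> "invariant_ring q" by fact
  have sub: "x \<in> invariants q" if "x \<in> \<aa>" for x
    using a_subset that by (auto simp: invariant_ring_def)
  have zero: "0 \<in> \<aa>" using additive_subgroup.zero_closed[OF is_additive_subgroup] by (simp add: invariant_ring_def)
  have add: "x + y \<in> \<aa>" if "x \<in> \<aa>" "y \<in> \<aa>" for x y
    using additive_subgroup.a_closed[OF is_additive_subgroup that] by (simp add: invariant_ring_def)
  have mult: "r * x \<in> \<aa>" if "r \<in> invariants q" "x \<in> \<aa>" for r x
    using I_l_closed[OF that(2)] that(1) by (simp add: invariant_ring_def)
  \<comment> \<open>This may be larger than the ideal generated by \<open>\<aa>\<close>, but its closure properties are immediate.\<close>
  define J where "J = {p \<in> polynomials q. \<forall>r\<in>polynomials q. reynolds q (r * p) \<in> \<aa>}"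
  have "poly_ideal q J"
    unfolding poly_ideal_def
  proof (intro conjI ballI subsetI)
    have "reynolds q 0 = 0" using reynolds_mult_invariant[of 0 q 0] by (simp add: invariants_closed)
    thus "0 \<in> J" by (simp add: J_def polynomials_closed zero)
    show "x + y \<in> J" if "x \<in> J" "y \<in> J" for x y
      using that by (simp add: J_def polynomials_closed distrib_left reynolds_add add)
    show "r * x \<in> J" if "r \<in> polynomials q" "x \<in> J" for r x
      using that by (simp add: J_def polynomials_closed flip: mult.assoc)
  qed (simp add: J_def)
  \<comment> \<open>For \<open>x\<close> in \<open>\<aa>\<close> the average of \<open>r * x\<close>
    is \<open>reynolds q r * x\<close>, a multiple of \<open>x\<close> inside the invariant
    ring.\<close>
  moreover have "\<aa> \<subseteq> J"
  proof
    fix x assume x: "x \<in> \<aa>"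
    have "x \<in> polynomials q" using sub[OF x] by (simp add: invariants_def)
    thus "x \<in> J"
      unfolding J_def using x sub by (auto simp: reynolds_mult_invariant intro: mult reynolds_in_invariants)
  qed
  hence "zero_locus q J \<subseteq> zero_locus q \<aa>" by (auto simp: zero_locus_def)
  moreover have "f \<in> polynomials q" using f by (simp add: invariants_def)
  ultimately obtain n where "f ^ n \<in> J" using nullstellensatz vanish by (metis subsetD)
  \<comment> \<open>The multiplier \<open>r = 1\<close> in the definition of \<open>J\<close> gives
    the average of \<open>f ^ n\<close> itself, which is \<open>f ^ n\<close> by invariance.\<close>
  hence "reynolds q (1 * f ^ n) \<in> \<aa>" using polynomials_closed(2) by (force simp: J_def)
  moreover have "f ^ n \<in> invariants q"
    using f by (induction n) (simp_all add: invariants_closed)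
  ultimately have "f ^ n \<in> \<aa>"
    using reynolds_mult_invariant[of "f ^ n" q 1] by (simp add: reynolds_one)
  thus ?thesis ..
qed

theorem theorem5p10:
  fixes \<Omega> :: "(real \<times> real \<Rightarrow> real) set"
    and q :: nat
    and \<aa> :: "sym_poly set"
    and g :: quantum_graph
  assumes "\<Omega> \<subseteq> kernels"
    and "q \<ge> 1"
    and "ideal \<aa> (invariant_ring q)"
    and "\<forall>X\<in>zero_locus q \<aa>. poly_eval X (theta q g) = 0"
  shows "g \<in> vanishing_ideal (kernel_variety_at \<Omega> q \<aa>) \<and>
         theta q g \<in> vanishing_ideal_at q (kernel_variety_at \<Omega> q \<aa>)"
proof -
  let ?V = "kernel_variety_at \<Omega> q \<aa>"
  obtain n where "theta q g ^ n \<in> \<aa>"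
    using invariant_nullstellensatz[OF assms(3) theta_in_invariants assms(4)] by blast
  hence n: "g ^ n \<in> theta q -` \<aa>" by (simp add: theta_power)
  have "quantum_density g W = 0" if W: "W \<in> ?V" for W
  proof -
    \<comment> \<open>Being a kernel makes the density multiplicative at \<open>W\<close>, so the
      density of \<open>g ^ n\<close> is the \<open>n\<close>-th power of that of \<open>g\<close>;
      a complex number with a vanishing power is zero.\<close>
    have "W \<in> kernels" "quantum_density (g ^ n) W = 0"
      using W n assms(1) unfolding kernel_variety_at_def kernel_variety_def by blast+
    thus ?thesis by (simp add: quantum_density_power)
  qed
  hence "g \<in> vanishing_ideal ?V" by (simp add: vanishing_ideal_def)
  thus ?thesis by (simp add: vanishing_ideal_at_def)
qed

end
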